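(* Let $n\in\mathbb{Z}_{\ge1}$, $s\in\mathbb{C}\setminus\{1\}$ and $z\in\mathbb{C}\setminus\mathbb{Z}_{<0}$. Then $$\zeta_H(z;s)=n^{-s}\sum_{j=1}^{n}\zeta_H\left(\frac{z}{n}-\frac{n-j}{n};s\right).$$
   Context: For $z_0\in\mathbb{C}\setminus\mathbb{Z}_{<0}$, $\zeta_H(z_0;s):=\sum_{m=1}^{\infty}(z_0+m)^{-s}$ (principal branch powers). The sum converges classically for $\mathrm{Re}(s)>1$ and is understood for $s\in\mathbb{C}\setminus\{1\}$ as a remainder Cesàro sum, which gives its analytic continuation in $s$ (in particular $\zeta_H(0;s)=\zeta(s)$). The remainder Cesàro sum is defined as follows. On the horizontal contour $\gamma(t)=z_0+t$, $t=k+\alpha$ with $k\in\mathbb{Z}_{\ge0}$, $0\le\alpha<1$, form the partial-sum function $F(t)=\sum_{m=1}^{k}(z_0+m)^{-s}$. The sum has value $L$ if $F(t)=\sum_{i}a_i(\gamma(t))^{\rho_i}(\ln\gamma(t))^{m_i}+R(t)$ (a finite sum, with $a_i\in\mathbb{C}$, $\rho_i\in\mathbb{C}\setminus\{0\}$, $m_i\in\mathbb{Z}_{\ge0}$) where $P^N[R](t)\to L$ as $t\to\infty$ for some $N\in\mathbb{Z}_{\ge0}$, with $P[h](t)=\frac1t\int_0^t h(u)\,du$. *)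

theory Defs
  imports "HOL-Complex_Analysis.Complex_Analysis"
begin

definition cesaro_mean :: "(real \<Rightarrow> complex) \<Rightarrow> real \<Rightarrow> complex" where
  "cesaro_mean h t = integral {0..t} h / of_real t"

(* The gauge integral is total with default value 0, so the existence of every integral that
   enters the N-fold mean is required explicitly. *)
definition has_cesaro_limit :: "(real \<Rightarrow> complex) \<Rightarrow> complex \<Rightarrow> bool" where
  "has_cesaro_limit h L \<longleftrightarrow>
     (\<exists>N. (\<forall>k<N. \<forall>t>0. (cesaro_mean ^^ k) h integrable_on {0..t}) \<and>
          ((cesaro_mean ^^ N) h \<longlongrightarrow> L) at_top)"

definition partial_sum_fun :: "(complex \<Rightarrow> complex) \<Rightarrow> complex \<Rightarrow> real \<Rightarrow> complex" where
  "partial_sum_fun f z0 t = (\<Sum>m=1..nat \<lfloor>t\<rfloor>. f (z0 + of_nat m))"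

(* The contour is z0 + t.  The powers and logarithms are meaningless at the point (if any) where
   z0 + t = 0, so R is unconstrained there; a single point does not affect the means of R. *)
definition has_remainder_cesaro_sum :: "(complex \<Rightarrow> complex) \<Rightarrow> complex \<Rightarrow> complex \<Rightarrow> bool" where
  "has_remainder_cesaro_sum f z0 L \<longleftrightarrow>
     (\<exists>(q::nat) (a :: nat \<Rightarrow> complex) (\<rho> :: nat \<Rightarrow> complex) (l :: nat \<Rightarrow> nat) (R :: real \<Rightarrow> complex).
        (\<forall>i<q. \<rho> i \<noteq> 0) \<and>
        (\<forall>t\<ge>0. z0 + of_real t \<noteq> 0 \<longrightarrow>
           partial_sum_fun f z0 t =
             (\<Sum>i<q. a i * (z0 + of_real t) powr \<rho> i * (Ln (z0 + of_real t)) ^ l i) + R t) \<and>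
        has_cesaro_limit R L)"

(* The summation starts at z0 + 1, unlike the usual Hurwitz zeta function: zeta_H 0 is the
   Riemann zeta function. *)
definition zeta_H :: "complex \<Rightarrow> complex \<Rightarrow> complex" where
  "zeta_H z0 s = (THE L. has_remainder_cesaro_sum (\<lambda>w. w powr (- s)) z0 L)"

end

theory Submission
  imports Defs "HOL-Real_Asymp.Real_Asymp"
begin

text \<open>
  Let \<open>F_z(t)\<close> be the sum of \<open>(z + m)^(-s)\<close> over \<open>1 \<le> m \<le> t\<close>, and let \<open>w_j = z/n - (n - j)/n\<close>. Grouping the
  terms of \<open>F_z\<close> by the residue of the index modulo \<open>n\<close> gives, without any error term,
  \<open>F_z(t) = n^(-s) \<Sum>j. F_{w_j}((t + n - j)/n)\<close>
  (\<open>partial_sum_fun_multisection\<close>), and under the same substitution all contours coincide up to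
  scaling, \<open>w_j + (t + n - j)/n = (z + t)/n\<close>. Consequently the pole terms \<open>(z + t)^(1-s)/(1-s)\<close> satisfy the same
  identity, and so do the remainders. The theorem follows by taking limits, provided that the
  remainder of \<open>F_z\<close> has a Cesaro limit that is unique and that does not change under
  \<open>t \<mapsto> (t + n - j)/n\<close>.

  The invariance is not visible for iterated averages over \<open>[0,t]\<close>, which single out the origin. They are
  therefore replaced by the relation \<open>cesaro_asymp\<close>, which compares iterated primitives with powers
  of \<open>t\<close> and only looks at large \<open>t\<close>; for it, invariance is \<open>cesaro_asymp_affine\<close>. The
  equivalence of both notions is a version of the classical theorem of Knopp and Schnee on Hoelder
  and Cesaro means (\<open>has_cesaro_limit_imp_cesaro_asymp\<close>, \<open>cesaro_asymp_imp_has_cesaro_limit\<close>).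

  Existence of the limit comes from Euler-Maclaurin summation: up to constants, the remainder is a
  periodic function of mean zero times a power, plus the integral of another such product
  (\<open>tail_primitive_hurwitz\<close>), and repeated integration by parts shows that these have Cesaro limits
  (\<open>cesaro_asymp_periodic_powr\<close>, \<open>cesaro_asymp_primitive_periodic_powr\<close>). Uniqueness holds because a sum of
  terms \<open>c w^\<rho> (ln w)^l\<close> with \<open>\<rho> \<noteq> 0\<close> can only have the Cesaro limit \<open>0\<close>: the Euler operator \<open>\<theta> = w d/dw\<close> maps
  functions with a Cesaro limit to functions with Cesaro limit \<open>0\<close>, so applying the factors \<open>\<theta> - \<rho>\<close> that
  annihilate the sum multiplies its limit by a non-zero number
  (\<open>cesaro_asymp_power_log_sum_eq_0\<close>).
\<close>

section \<open>Integrability and primitives near infinity\<close>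

text \<open>
  Whether a function has a Cesaro limit, and which one, depends only on its values for large
  arguments. Everything is therefore stated on some unspecified half-line, which makes the theory
  invariant under translations of the argument and blind to the point where the contour
  \<open>z + t\<close> may meet the singularity of the powers and of the logarithm.
\<close>

definition tail_integrable :: "(real \<Rightarrow> complex) \<Rightarrow> bool" where
  "tail_integrable h \<longleftrightarrow> (\<exists>T. \<forall>a b. T \<le> a \<longrightarrow> a \<le> b \<longrightarrow> h integrable_on {a..b})"

definition tail_primitive :: "(real \<Rightarrow> complex) \<Rightarrow> (real \<Rightarrow> complex) \<Rightarrow> bool" where
  "tail_primitive h H \<longleftrightarrow>
     (\<exists>T. \<forall>a b. T \<le> a \<longrightarrow> a \<le> b \<longrightarrow> (h has_integral (H b - H a)) {a..b})"

lemma tail_integrable_if_primitive: "tail_primitive h H \<Longrightarrow> tail_integrable h"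
  unfolding tail_primitive_def tail_integrable_def by (meson has_integral_integrable)

lemma tail_primitive_from_base:
  assumes "\<And>t. t \<ge> T \<Longrightarrow> (h has_integral (H t - H T)) {T..t}"
  shows "tail_primitive h H"
  unfolding tail_primitive_def
proof (intro exI allI impI)
  fix a b :: real assume ab: "T \<le> a" "a \<le> b"
  have i: "h integrable_on {T..b}" using assms[of b] ab by (auto intro: has_integral_integrable)
  have j: "h integrable_on {a..b}" using ab by (intro integrable_on_subinterval[OF i]) auto
  have "integral {T..a} h + integral {a..b} h = integral {T..b} h"
    using Henstock_Kurzweil_Integration.integral_combine[OF ab i] .
  moreover have "integral {T..a} h = H a - H T" "integral {T..b} h = H b - H T"
    using assms ab by (auto intro!: integral_unique)
  ultimately have "integral {a..b} h = H b - H a" by (simp add: algebra_simps)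
  then show "(h has_integral (H b - H a)) {a..b}" using j by (metis integrable_integral)
qed

lemma tail_primitive_exists:
  assumes "tail_integrable h" obtains H where "tail_primitive h H"
proof -
  obtain T where T: "\<And>a b. T \<le> a \<Longrightarrow> a \<le> b \<Longrightarrow> h integrable_on {a..b}"
    using assms unfolding tail_integrable_def by blast
  have "tail_primitive h (\<lambda>t. integral {T..t} h)"
    by (rule tail_primitive_from_base[of T]) (use T in \<open>auto intro: integrable_integral\<close>)
  then show ?thesis using that by blast
qed

lemma tail_primitive_add:
  assumes "tail_primitive h H" "tail_primitive g G"
  shows "tail_primitive (\<lambda>t. h t + g t) (\<lambda>t. H t + G t)"
proof -
  obtain T where T: "\<And>a b. T \<le> a \<Longrightarrow> a \<le> b \<Longrightarrow> (h has_integral (H b - H a)) {a..b}"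
    using assms(1) unfolding tail_primitive_def by blast
  obtain T' where T': "\<And>a b. T' \<le> a \<Longrightarrow> a \<le> b \<Longrightarrow> (g has_integral (G b - G a)) {a..b}"
    using assms(2) unfolding tail_primitive_def by blast
  show ?thesis unfolding tail_primitive_def
  proof (intro exI[of _ "max T T'"] allI impI)
    fix a b assume "max T T' \<le> a" "a \<le> b"
    then show "((\<lambda>t. h t + g t) has_integral (H b + G b) - (H a + G a)) {a..b}"
      using has_integral_add[OF T[of a b] T'[of a b]] by (simp add: algebra_simps)
  qed
qed

lemma tail_primitive_cmult:
  assumes "tail_primitive h H"
  shows "tail_primitive (\<lambda>t. c * h t) (\<lambda>t. c * H t)"
proof -
  obtain T where T: "\<And>a b. T \<le> a \<Longrightarrow> a \<le> b \<Longrightarrow> (h has_integral (H b - H a)) {a..b}"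
    using assms unfolding tail_primitive_def by blast
  show ?thesis unfolding tail_primitive_def right_diff_distrib[symmetric]
    by (intro exI[of _ T] allI impI has_integral_mult_right T)
qed

lemma tail_primitive_diff:
  assumes "tail_primitive h H" "tail_primitive g G"
  shows "tail_primitive (\<lambda>t. h t - g t) (\<lambda>t. H t - G t)"
  using tail_primitive_add[OF assms(1) tail_primitive_cmult[OF assms(2), of "-1"]] by simp

lemma tail_integrable_add:
  assumes "tail_integrable h" "tail_integrable g"
  shows "tail_integrable (\<lambda>t. h t + g t)"
  by (rule tail_primitive_exists[OF assms(1)], rule tail_primitive_exists[OF assms(2)])
     (blast intro: tail_primitive_add tail_integrable_if_primitive)

lemma tail_integrable_cmult:
  assumes "tail_integrable h" shows "tail_integrable (\<lambda>t. c * h t)"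
  by (rule tail_primitive_exists[OF assms])
     (blast intro: tail_primitive_cmult tail_integrable_if_primitive)

lemma tail_integrable_eventually_eq:
  assumes "tail_integrable h" "eventually (\<lambda>t. h t = g t) at_top"
  shows "tail_integrable g"
proof -
  obtain T where T: "\<And>a b. T \<le> a \<Longrightarrow> a \<le> b \<Longrightarrow> h integrable_on {a..b}"
    using assms unfolding tail_integrable_def by blast
  obtain T' where T': "\<And>t. t \<ge> T' \<Longrightarrow> h t = g t"
    using assms(2) unfolding eventually_at_top_linorder by blast
  show ?thesis unfolding tail_integrable_def
    by (intro exI[of _ "max T T'"] allI impI integrable_eq[OF T]) (use T' in auto)
qed

lemma tail_integrable_continuous:
  assumes "continuous_on {T..} h" shows "tail_integrable h"
  unfolding tail_integrable_def
  by (intro exI[of _ T] allI impI integrable_continuous_interval continuous_on_subset[OF assms]) auto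

lemma tail_primitive_continuous:
  assumes "tail_primitive h H" shows "\<exists>T. continuous_on {T..} H"
proof -
  obtain T where T: "\<And>a b. T \<le> a \<Longrightarrow> a \<le> b \<Longrightarrow> (h has_integral (H b - H a)) {a..b}"
    using assms unfolding tail_primitive_def by blast
  have "continuous_on {T..b} H" for b
  proof (cases "T \<le> b")
    case True
    have "continuous_on {T..b} (\<lambda>t. H T + integral {T..t} h)"
      using T[OF order_refl True] by (intro continuous_intros indefinite_integral_continuous_1)
        (auto intro: has_integral_integrable)
    then show ?thesis
      by (rule continuous_on_eq) (simp add: integral_unique[OF T])
  qed auto
  then have "isCont H t" if "t > T" for t
    using continuous_on_interior[of "{T..t+1}" H t] that by simp
  then have "continuous_on {T+1..} H" by (intro continuous_at_imp_continuous_on) auto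
  then show ?thesis by blast
qed

lemma tail_integrable_primitive: "tail_primitive h H \<Longrightarrow> tail_integrable H"
  using tail_primitive_continuous tail_integrable_continuous by blast

lemma tail_primitive_deriv:
  assumes "\<And>t. t \<ge> T \<Longrightarrow> (H has_vector_derivative h t) (at t)"
  shows "tail_primitive h H"
  by (intro tail_primitive_from_base[of T] fundamental_theorem_of_calculus)
     (auto intro: assms has_vector_derivative_at_within)

text \<open>
  Averaging never destroys a limit; this is the regularity of Cesaro summation at the level of
  primitives. The constant of integration is harmless because it is \<open>O(1) = o(t^(a+1))\<close>.
\<close>

lemma primitive_growth:
  assumes g: "((\<lambda>t. g t / of_real t ^ a) \<longlongrightarrow> l) at_top" and P: "tail_primitive g G"
  shows "((\<lambda>t. G t / of_real t ^ Suc a) \<longlongrightarrow> l / of_nat (Suc a)) at_top"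
proof -
  obtain T where T: "\<And>a b. T \<le> a \<Longrightarrow> a \<le> b \<Longrightarrow> (g has_integral (G b - G a)) {a..b}"
    using P unfolding tail_primitive_def by blast
  define D where "D t = G t - l / of_nat (Suc a) * of_real t ^ Suc a" for t :: real
  have "((\<lambda>t. D t / of_real t ^ Suc a) \<longlongrightarrow> 0) at_top"
  proof (rule tendstoI)
    fix e :: real assume e: "e > 0"
    have "eventually (\<lambda>t. dist (g t / of_real t ^ a) l < e/2) at_top" 
      by (rule tendstoD[OF g]) (use e in simp)
    then obtain S where S: "\<And>t. t \<ge> S \<Longrightarrow> dist (g t / of_real t ^ a) l < e/2"
      unfolding eventually_at_top_linorder by blast
    define M where "M = max 1 (max T S)"
    have M: "M \<ge> 1" "M \<ge> T" "M \<ge> S" by (auto simp: M_def)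
    have bd: "norm (D t - D M) \<le> e/2 * t ^ Suc a" if t: "t \<ge> M" for t
    proof -
      have pw: "((\<lambda>u. of_real u ^ a) has_integral ((of_real t ^ Suc a - of_real M ^ Suc a) / of_nat (Suc a) :: complex)) {M..t}"
      proof -
        have "((\<lambda>w. w ^ Suc a / of_nat (Suc a)) has_field_derivative of_real x ^ a) (at (of_real x :: complex))" for x :: real
          by (rule derivative_eq_intros refl)+ (simp_all del: of_nat_Suc)
        then have "((\<lambda>u::real. (of_real u ^ a :: complex)) has_integral (of_real t ^ Suc a / of_nat (Suc a) - of_real M ^ Suc a / of_nat (Suc a) :: complex)) {M..t}"
          by (intro fundamental_theorem_of_calculus has_vector_derivative_real_field t)
        then show ?thesis by (simp add: diff_divide_distrib del: of_nat_Suc)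
      qed
      have pr: "((\<lambda>u. u ^ a) has_integral ((t ^ Suc a - M ^ Suc a) / real (Suc a))) {M..t}"
      proof -
        have "((\<lambda>u::real. u ^ a) has_integral (t ^ Suc a / real (Suc a) - M ^ Suc a / real (Suc a))) {M..t}"
          by (intro fundamental_theorem_of_calculus)
             (use t in \<open>auto intro!: derivative_eq_intros simp flip: has_real_derivative_iff_has_vector_derivative simp del: of_nat_Suc power_Suc\<close>)
        then show ?thesis by (simp add: diff_divide_distrib del: of_nat_Suc)
      qed
      have h1: "((\<lambda>u. g u - l * of_real u ^ a) has_integral (D t - D M)) {M..t}"
        using has_integral_diff[OF T[OF M(2) t] has_integral_mult_right[OF pw, of l]]
        unfolding D_def by (simp add: diff_divide_distrib right_diff_distrib algebra_simps del: power_Suc of_nat_Suc)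
      have h2: "((\<lambda>u. e/2 * u ^ a) has_integral (e/2 * ((t ^ Suc a - M ^ Suc a) / real (Suc a)))) {M..t}"
        by (rule has_integral_mult_right[OF pr])
      have le: "norm (g u - l * of_real u ^ a) \<le> e/2 * u ^ a" if "u \<in> {M..t}" for u
      proof -
        have u: "u > 0" "u \<ge> S" using that M by auto
        then have "g u - l * of_real u ^ a = (g u / of_real u ^ a - l) * of_real u ^ a"
          by (simp add: field_simps)
        also have "norm \<dots> = dist (g u / of_real u ^ a) l * u ^ a"
          using u by (simp add: norm_mult dist_norm norm_power)
        also have "\<dots> \<le> e/2 * u ^ a"
          using S[OF u(2)] u by (intro mult_right_mono) auto
        finally show ?thesis .
      qed
      have "norm (integral {M..t} (\<lambda>u. g u - l * of_real u ^ a)) \<le> integral {M..t} (\<lambda>u. e/2 * u ^ a)"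
        by (rule integral_norm_bound_integral) (use h1 h2 le in \<open>auto simp: has_integral_integrable_integral\<close>)
      then have "norm (D t - D M) \<le> e/2 * ((t ^ Suc a - M ^ Suc a) / real (Suc a))"
        unfolding integral_unique[OF h1] integral_unique[OF h2] .
      also have "\<dots> \<le> e/2 * t ^ Suc a"
      proof -
        have "(t ^ Suc a - M ^ Suc a) / real (Suc a) \<le> t ^ Suc a / 1"
          using M t by (intro frac_le) auto
        then show ?thesis using e by (intro mult_left_mono) auto
      qed
      finally show ?thesis .
    qed
    have "((\<lambda>t. norm (D M) / t ^ Suc a) \<longlongrightarrow> 0) at_top"
      by (intro real_tendsto_divide_at_top[OF tendsto_const] filterlim_pow_at_top filterlim_ident) auto
    then have "eventually (\<lambda>t. norm (D M) / t ^ Suc a < e/2) at_top"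
      using e by (intro order_tendstoD(2)) auto
    then show "eventually (\<lambda>t. dist (D t / of_real t ^ Suc a) 0 < e) at_top"
      using eventually_ge_at_top[of M]
    proof eventually_elim
      case (elim t)
      then have t: "t > 0" using M by simp
      have "norm (D t) \<le> norm (D M) + e/2 * t ^ Suc a"
        using bd[OF elim(2)] norm_triangle_sub[of "D t" "D M"] by linarith
      also have "\<dots> < e/2 * t ^ Suc a + e/2 * t ^ Suc a"
        using elim(1) t by (simp add: pos_divide_less_eq del: power_Suc)
      finally have "norm (D t) < e * t ^ Suc a" by simp
      then show ?case using t by (simp add: norm_divide norm_mult norm_power pos_divide_less_eq)
    qed
  qed
  then have "((\<lambda>t. D t / of_real t ^ Suc a + l / of_nat (Suc a)) \<longlongrightarrow> 0 + l / of_nat (Suc a)) at_top"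
    by (intro tendsto_intros)
  moreover have "eventually (\<lambda>t. D t / of_real t ^ Suc a + l / of_nat (Suc a) = G t / of_real t ^ Suc a) at_top"
    using eventually_gt_at_top[of 0]
  proof eventually_elim
    case (elim t)
    then have "(of_real t :: complex) ^ Suc a \<noteq> 0" by simp
    then show ?case
      unfolding D_def by (simp add: diff_divide_distrib del: power_Suc of_nat_Suc)
  qed
  ultimately show ?thesis unfolding add_0 by (rule Lim_transform_eventually)
qed

section \<open>Cesaro asymptotics\<close>

text \<open>
  \<open>cesaro_asymp a h L\<close> means \<open>h(t) ~ L t^a\<close> after smoothing: some iterated primitive of \<open>h\<close>
  behaves like the corresponding iterated primitive of \<open>L t^a\<close>. For \<open>a = 0\<close> this is
  summability by Riesz means of some order, except that constants of integration are left free.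
  The exponent is kept general because each integration raises it by one.
\<close>

inductive cesaro_asymp :: "nat \<Rightarrow> (real \<Rightarrow> complex) \<Rightarrow> complex \<Rightarrow> bool" where
  base: "tail_integrable h \<Longrightarrow> ((\<lambda>t. h t / of_real t ^ a) \<longlongrightarrow> L) at_top \<Longrightarrow> cesaro_asymp a h L"
| step: "tail_primitive h H \<Longrightarrow> cesaro_asymp (Suc a) H (L / of_nat (Suc a)) \<Longrightarrow> cesaro_asymp a h L"

lemma cesaro_asymp_tail_integrable: "cesaro_asymp a h L \<Longrightarrow> tail_integrable h"
  by (induction rule: cesaro_asymp.induct) (auto intro: tail_integrable_if_primitive)

text \<open>
  Besides being a step towards additivity, this shows that the constants of integration in a
  chain of primitives can be chosen at will.
\<close>

lemma cesaro_asymp_add_base: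
  assumes "cesaro_asymp a h L" "tail_integrable e" "((\<lambda>t. e t / of_real t ^ a) \<longlongrightarrow> l) at_top"
  shows "cesaro_asymp a (\<lambda>t. h t + e t) (L + l)"
  using assms
proof (induction arbitrary: e l rule: cesaro_asymp.induct)
  case (base h a L)
  show ?case
    by (rule cesaro_asymp.base)
       (use tail_integrable_add[OF base(1,3)] tendsto_add[OF base(2,4)] in \<open>simp_all add: add_divide_distrib\<close>)
next
  case (step h H a L)
  obtain E where E: "tail_primitive e E" using tail_primitive_exists[OF step.prems(1)] .
  have "cesaro_asymp (Suc a) (\<lambda>t. H t + E t) (L / of_nat (Suc a) + l / of_nat (Suc a))"
    by (rule step.IH[OF tail_integrable_primitive[OF E] primitive_growth[OF step.prems(2) E]])
  then show ?case
    by (intro cesaro_asymp.step[OF tail_primitive_add[OF step.hyps(1) E]]) (simp add: add_divide_distrib)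
qed

lemma cesaro_asymp_eventually_eq:
  assumes "cesaro_asymp a h L" "eventually (\<lambda>t. h t = g t) at_top"
  shows "cesaro_asymp a g L"
proof -
  have ev: "eventually (\<lambda>t. g t - h t = 0) at_top" using assms(2) by eventually_elim simp
  have "tail_integrable (\<lambda>t. 0 :: complex)"
    by (rule tail_integrable_continuous[of 0]) (rule continuous_intros)
  then have "tail_integrable (\<lambda>t. g t - h t)"
    by (rule tail_integrable_eventually_eq) (use ev in eventually_elim, simp)
  moreover have "((\<lambda>t. (g t - h t) / of_real t ^ a) \<longlongrightarrow> 0) at_top"
    by (rule tendsto_eventually) (use ev in eventually_elim, simp)
  ultimately show ?thesis using cesaro_asymp_add_base[OF assms(1)] by fastforce
qed

text \<open>
  Two chains of primitives can be of different lengths. Passing to a primitive is reversible, so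
  chains can be lengthened until they match; additivity rests on this.
\<close>

lemma cesaro_asymp_primitive_iff:
  assumes P: "tail_primitive g G"
  shows "cesaro_asymp a g L \<longleftrightarrow> cesaro_asymp (Suc a) G (L / of_nat (Suc a))"
proof
  assume "cesaro_asymp a g L"
  then show "cesaro_asymp (Suc a) G (L / of_nat (Suc a))"
    using P
  proof cases
    case base
    then show ?thesis
      using P by (intro cesaro_asymp.base primitive_growth) (auto intro: tail_integrable_primitive)
  next
    case (step H)
    have Z: "tail_primitive (\<lambda>t. 0) (\<lambda>t. G t - H t)"
      using tail_primitive_diff[OF P step(1)] by simp
    have "((\<lambda>t. (G t - H t) / of_real t ^ Suc a) \<longlongrightarrow> 0 / of_nat (Suc a)) at_top"
      by (rule primitive_growth[OF _ Z]) simp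
    then show ?thesis
      using cesaro_asymp_add_base[OF step(2) tail_integrable_primitive[OF Z], of 0] by simp
  qed
qed (rule cesaro_asymp.step[OF P])

lemma cesaro_asymp_add:
  assumes "cesaro_asymp a h L" "cesaro_asymp a g M"
  shows "cesaro_asymp a (\<lambda>t. h t + g t) (L + M)"
  using assms(2,1)
proof (induction arbitrary: h L rule: cesaro_asymp.induct)
  case (base g a M)
  then show ?case by (intro cesaro_asymp_add_base)
next
  case (step g G a M)
  obtain H where H: "tail_primitive h H"
    using tail_primitive_exists[OF cesaro_asymp_tail_integrable[OF step.prems]] .
  have "cesaro_asymp (Suc a) (\<lambda>t. H t + G t) (L / of_nat (Suc a) + M / of_nat (Suc a))"
    using step.prems by (intro step.IH) (simp only: cesaro_asymp_primitive_iff[OF H])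
  then show ?case
    by (intro cesaro_asymp.step[OF tail_primitive_add[OF H step.hyps(1)]]) (simp add: add_divide_distrib)
qed

lemma cesaro_asymp_cmult:
  assumes "cesaro_asymp a h L"
  shows "cesaro_asymp a (\<lambda>t. c * h t) (c * L)"
  using assms
proof (induction rule: cesaro_asymp.induct)
  case (base h a L)
  show ?case
    by (rule cesaro_asymp.base)
       (use tail_integrable_cmult[OF base(1)] tendsto_mult_left[OF base(2), of c] in simp_all)
next
  case (step h H a L)
  then show ?case
    by (intro cesaro_asymp.step[OF tail_primitive_cmult[OF step.hyps(1)]]) simp
qed

lemma cesaro_asymp_diff:
  assumes "cesaro_asymp a h L" "cesaro_asymp a g M"
  shows "cesaro_asymp a (\<lambda>t. h t - g t) (L - M)"
  using cesaro_asymp_add[OF assms(1) cesaro_asymp_cmult[OF assms(2), of "-1"]] by simp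

lemma cesaro_asymp_sum:
  assumes "finite I" "\<And>i. i \<in> I \<Longrightarrow> cesaro_asymp a (h i) (L i)"
  shows "cesaro_asymp a (\<lambda>t. \<Sum>i\<in>I. h i t) (\<Sum>i\<in>I. L i)"
  using assms
proof (induction rule: finite_induct)
  case empty
  show ?case by (rule cesaro_asymp.base) (auto intro!: tail_integrable_continuous[of 0])
next
  case (insert i I)
  then show ?case using cesaro_asymp_add[of a "h i" "L i"] by simp
qed

lemma cesaro_asymp_limit_unique:
  assumes "cesaro_asymp a h L" "((\<lambda>t. h t / of_real t ^ a) \<longlongrightarrow> l) at_top"
  shows "L = l"
  using assms
proof (induction arbitrary: l rule: cesaro_asymp.induct)
  case (base h a L)
  then show ?case using tendsto_unique[OF _ base(2,3)] by simp
next
  case (step h H a L)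
  have "L / of_nat (Suc a) = l / of_nat (Suc a)"
    by (rule step.IH[OF primitive_growth[OF step.prems step.hyps(1)]])
  then show ?case by (simp del: of_nat_Suc)
qed

lemma filterlim_affine_at_top:
  assumes "(c::real) > 0" shows "filterlim (\<lambda>t. c * t + d) at_top at_top"
  using assms by real_asymp

lemma tail_primitive_affine:
  assumes "tail_primitive h H" "c > 0"
  shows "tail_primitive (\<lambda>t. h (c * t + d)) (\<lambda>t. H (c * t + d) / of_real c)"
proof -
  obtain T where T: "\<And>a b. T \<le> a \<Longrightarrow> a \<le> b \<Longrightarrow> (h has_integral (H b - H a)) {a..b}"
    using assms unfolding tail_primitive_def by blast
  show ?thesis unfolding tail_primitive_def
  proof (intro exI[of _ "(T - d) / c"] allI impI)
    fix a b assume ab: "(T - d) / c \<le> a" "a \<le> b"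
    then have "T \<le> c * a + d" "c * a + d \<le> c * b + d" using assms(2) by (auto simp: field_simps)
    from T[OF this]
    have "(h has_integral (H (c*b+d) - H (c*a+d))) (cbox (c*a+d) (c*b+d))" by simp
    from has_integral_affinity'[OF this assms(2), of d]
    show "((\<lambda>t. h (c*t+d)) has_integral H (c*b+d) / of_real c - H (c*a+d) / of_real c) {a..b}"
      using assms(2) by (simp add: scaleR_conv_of_real field_simps)
  qed
qed

text \<open>
  The property on which the theorem hinges: iterated primitives transform trivially under an
  affine change of variable, whereas iterated averages from \<open>0\<close> do not.
\<close>

lemma cesaro_asymp_affine:
  assumes "cesaro_asymp a h L" "c > 0"
  shows "cesaro_asymp a (\<lambda>t. h (c * t + d)) (of_real c ^ a * L)"
  using assms
proof (induction rule: cesaro_asymp.induct)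
  case (base h a L)
  have lim: "((\<lambda>t. h (c * t + d) / of_real (c * t + d) ^ a) \<longlongrightarrow> L) at_top"
    by (rule filterlim_compose[OF base(2) filterlim_affine_at_top[OF base(3)]])
  have "((\<lambda>t. (c * t + d) / t) \<longlongrightarrow> c) at_top" by real_asymp
  then have "((\<lambda>t. of_real ((c * t + d) / t) ^ a) \<longlongrightarrow> (of_real c ^ a :: complex)) at_top"
    by (intro tendsto_intros)
  from tendsto_mult[OF this lim]
  have lim': "((\<lambda>t. h (c * t + d) / of_real t ^ a) \<longlongrightarrow> of_real c ^ a * L) at_top"
  proof (rule Lim_transform_eventually)
    have "eventually (\<lambda>t. c * t + d > 0) at_top"
      using filterlim_affine_at_top[OF base(3)] unfolding filterlim_at_top_dense by blast
    then show "\<forall>\<^sub>F t in at_top. of_real ((c * t + d) / t) ^ a * (h (c * t + d) / of_real (c * t + d) ^ a) =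
            h (c * t + d) / of_real t ^ a"
      using eventually_gt_at_top[of 0]
    proof eventually_elim
      case (elim t)
      define x :: complex where "x = of_real (c * t + d)"
      have "x \<noteq> 0" unfolding x_def of_real_eq_0_iff using elim(1) by simp
      then show ?case
        unfolding of_real_divide x_def[symmetric] by (simp add: power_divide)
    qed
  qed
  obtain H where H: "tail_primitive h H" using tail_primitive_exists[OF base(1)] .
  show ?case
    by (rule cesaro_asymp.base[OF tail_integrable_if_primitive[OF tail_primitive_affine[OF H base(3)]] lim'])
next
  case (step h H a L)
  have "cesaro_asymp (Suc a) (\<lambda>t. (1 / of_real c) * H (c * t + d)) (1 / of_real c * (of_real c ^ Suc a * (L / of_nat (Suc a))))"
    by (intro cesaro_asymp_cmult step.IH step.prems)
  moreover have "1 / of_real c * (of_real c ^ Suc a * (L / of_nat (Suc a))) = of_real c ^ a * L / of_nat (Suc a)"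
    using step.prems by simp
  ultimately show ?case
    by (intro cesaro_asymp.step[OF tail_primitive_affine[OF step.hyps(1) step.prems]])
       (simp only: mult_1_left times_divide_eq_left)
qed

text \<open>
  Integration by parts. Continuity of \<open>g\<close> reduces it to the product rule.
\<close>

lemma tail_primitive_mult_ident:
  assumes P: "tail_primitive g G" and c: "\<exists>T. continuous_on {T..} g" and P2: "tail_primitive G G2"
  shows "tail_primitive (\<lambda>t. of_real t * g t) (\<lambda>t. of_real t * G t - G2 t)"
proof -
  obtain S where S: "continuous_on {S..} g" using c by blast
  obtain T where T: "\<And>a b. T \<le> a \<Longrightarrow> a \<le> b \<Longrightarrow> (g has_integral (G b - G a)) {a..b}"
    using P unfolding tail_primitive_def by blast
  obtain U where U: "\<And>a b. U \<le> a \<Longrightarrow> a \<le> b \<Longrightarrow> (G has_integral (G2 b - G2 a)) {a..b}"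
    using P2 unfolding tail_primitive_def by blast
  obtain V where V: "continuous_on {V..} G" using tail_primitive_continuous[OF P] by blast
  define W where "W = max (max S T) (max U V)"
  have W: "W \<ge> S" "W \<ge> T" "W \<ge> U" "W \<ge> V" by (auto simp: W_def)
  have deriv: "(F has_vector_derivative f t) (at t)"
    if c: "continuous_on {W..} f" and F: "\<And>b. W \<le> b \<Longrightarrow> (f has_integral (F b - F W)) {W..b}" and t: "t > W"
    for f F :: "real \<Rightarrow> complex" and t
  proof -
    have "((\<lambda>u. integral {W..u} f) has_vector_derivative f t) (at t within {W..t+1})"
      by (rule integral_has_vector_derivative[OF continuous_on_subset[OF c]]) (use t in auto)
    then have "((\<lambda>u. integral {W..u} f) has_vector_derivative f t) (at t)"
      using t at_within_interior[of t "{W..t+1}"] by simp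
    then have "((\<lambda>u. F W + integral {W..u} f) has_vector_derivative f t) (at t)"
      by (auto intro: derivative_eq_intros)
    then show ?thesis
      by (rule has_vector_derivative_transform_within_open[where S="{W<..}"])
         (use t in \<open>auto simp: integral_unique[OF F]\<close>)
  qed
  show ?thesis
  proof (rule tail_primitive_deriv[of "W + 1"])
    fix t assume t: "W + 1 \<le> t"
    have 1: "(G has_vector_derivative g t) (at t)"
      by (rule deriv) (use W t S T in \<open>auto intro: continuous_on_subset\<close>)
    have 2: "(G2 has_vector_derivative G t) (at t)"
      by (rule deriv) (use W t V U in \<open>auto intro: continuous_on_subset\<close>)
    have 3: "(of_real has_vector_derivative (1::complex)) (at t)"
      using has_vector_derivative_of_real[OF DERIV_ident] by simp
    show "((\<lambda>t. of_real t * G t - G2 t) has_vector_derivative of_real t * g t) (at t)"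
      using has_vector_derivative_diff[OF has_vector_derivative_mult[OF 3 1] 2] by simp
  qed
qed

text \<open>
  If \<open>G\<close> is a primitive of \<open>g\<close> and \<open>G2\<close> one of \<open>G\<close>, then \<open>t G - G2\<close> is a primitive of \<open>t g\<close>, and the
  leading coefficients agree because \<open>1/(a+1) - 1/((a+1)(a+2)) = 1/(a+2)\<close>.
\<close>

lemma cesaro_asymp_mult_ident:
  assumes "cesaro_asymp a g L" "\<exists>T. continuous_on {T..} g"
  shows "cesaro_asymp (Suc a) (\<lambda>t. of_real t * g t) L"
  using assms
proof (induction rule: cesaro_asymp.induct)
  case (base g a L)
  obtain T where "continuous_on {T..} g" using base(3) by blast
  then have "tail_integrable (\<lambda>t. of_real t * g t)"
    by (intro tail_integrable_continuous[of T] continuous_intros)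
  moreover have "((\<lambda>t. of_real t * g t / of_real t ^ Suc a) \<longlongrightarrow> L) at_top"
    by (rule Lim_transform_eventually[OF base(2) eventually_mono[OF eventually_gt_at_top[of 0]]]) simp
  ultimately show ?case by (rule cesaro_asymp.base)
next
  case (step g G a L)
  obtain G2 where G2: "tail_primitive G G2"
    using tail_primitive_exists[OF tail_integrable_primitive[OF step.hyps(1)]] .
  have "cesaro_asymp (Suc (Suc a)) G2 (L / of_nat (Suc a) / of_nat (Suc (Suc a)))"
    using step.hyps(2) by (simp only: cesaro_asymp_primitive_iff[OF G2])
  from cesaro_asymp_diff[OF step.IH[OF tail_primitive_continuous[OF step.hyps(1)]] this]
  have "cesaro_asymp (Suc (Suc a)) (\<lambda>t. of_real t * G t - G2 t)
          (L / of_nat (Suc a) - L / of_nat (Suc a) / of_nat (Suc (Suc a)))" .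
  also have "L / of_nat (Suc a) - L / of_nat (Suc a) / of_nat (Suc (Suc a)) = L / of_nat (Suc (Suc a))"
  proof -
    have "L / x - L / x / (1 + x) = L / (1 + x)" if "x \<noteq> 0" "1 + x \<noteq> 0" for x :: complex
      using that by (simp add: divide_simps) (simp add: algebra_simps)
    moreover have "of_nat (Suc a) \<noteq> (0::complex)" "of_nat (Suc (Suc a)) \<noteq> (0::complex)"
      by (simp_all only: of_nat_eq_0_iff)
    ultimately show ?thesis by (simp only: of_nat_Suc[of "Suc a"])
  qed
  finally show ?case
    by (rule cesaro_asymp.step[OF tail_primitive_mult_ident[OF step.hyps(1) step.prems G2]])
qed

section \<open>From iterated means to Cesaro asymptotics\<close>

lemma continuous_on_integral_from_0:
  fixes h :: "real \<Rightarrow> complex"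
  assumes i: "\<And>t. t > 0 \<Longrightarrow> h integrable_on {0..t}"
  shows "continuous_on {0<..} (\<lambda>t. integral {0..t} h)"
proof (intro continuous_at_imp_continuous_on ballI)
  fix t :: real assume t: "t \<in> {0<..}"
  have "continuous_on {0..t+1} (\<lambda>t. integral {0..t} h)"
    by (intro indefinite_integral_continuous_1 i) (use t in simp)
  then show "isCont (\<lambda>t. integral {0..t} h) t"
    by (rule continuous_on_interior) (use t in simp)
qed

lemma tail_primitive_integral_from_0:
  fixes h :: "real \<Rightarrow> complex"
  assumes i: "\<And>t. t > 0 \<Longrightarrow> h integrable_on {0..t}"
  shows "tail_primitive h (\<lambda>t. integral {0..t} h)"
proof (rule tail_primitive_from_base[of 1])
  fix t :: real assume t: "t \<ge> 1"
  have "integral {0..1} h + integral {1..t} h = integral {0..t} h"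
    using t by (intro Henstock_Kurzweil_Integration.integral_combine i) auto
  moreover have "h integrable_on {1..t}"
    by (rule integrable_on_subinterval[OF i[of t]]) (use t in auto)
  ultimately show "(h has_integral integral {0..t} h - integral {0..1} h) {1..t}"
    by (simp add: has_integral_integrable_integral algebra_simps)
qed

lemma continuous_on_cesaro_mean:
  assumes "\<And>t. t > 0 \<Longrightarrow> h integrable_on {0..t}"
  shows "continuous_on {0<..} (cesaro_mean h)"
  unfolding cesaro_mean_def[abs_def]
  by (intro continuous_intros continuous_on_integral_from_0 assms) auto

text \<open>
  Averaging is undone by \<open>g \<mapsto> (t g)'\<close>: multiplication by \<open>t\<close> raises the exponent from \<open>0\<close> to \<open>1\<close>,
  differentiation lowers it again, and the coefficient is unchanged.
\<close>

lemma cesaro_asymp_of_cesaro_mean: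
  assumes i: "\<And>t. t > 0 \<Longrightarrow> h integrable_on {0..t}" and c: "cesaro_asymp 0 (cesaro_mean h) L"
  shows "cesaro_asymp 0 h L"
proof -
  have P: "tail_primitive h (\<lambda>t. integral {0..t} h)" by (rule tail_primitive_integral_from_0[OF i])
  have "continuous_on {1..} (cesaro_mean h)"
    by (rule continuous_on_subset[OF continuous_on_cesaro_mean[OF i]]) auto
  then have "cesaro_asymp (Suc 0) (\<lambda>t. of_real t * cesaro_mean h t) L"
    by (intro cesaro_asymp_mult_ident[OF c] exI)
  then have "cesaro_asymp (Suc 0) (\<lambda>t. integral {0..t} h) L"
    by (rule cesaro_asymp_eventually_eq)
       (use eventually_gt_at_top[of 0] in eventually_elim, simp add: cesaro_mean_def)
  then show ?thesis by (intro cesaro_asymp.step[OF P]) simp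
qed

text \<open>
  Integrability near the origin enters only through the means that actually occur; the function
  itself may be singular there when no mean is taken.
\<close>

lemma has_cesaro_limit_imp_cesaro_asymp:
  assumes lim: "has_cesaro_limit R L" and R: "tail_integrable R"
  shows "cesaro_asymp 0 R L"
proof -
  obtain N where N: "\<And>k t. k < N \<Longrightarrow> t > 0 \<Longrightarrow> (cesaro_mean ^^ k) R integrable_on {0..t}"
    "((cesaro_mean ^^ N) R \<longlongrightarrow> L) at_top" using lim unfolding has_cesaro_limit_def by blast
  have "cesaro_asymp 0 ((cesaro_mean ^^ k) R) L" if "k \<le> N" for k
    using that
  proof (induction rule: inc_induct)
    case base
    have "tail_integrable ((cesaro_mean ^^ N) R)"
    proof (cases N)
      case (Suc M)
      have "continuous_on {1..} (cesaro_mean ((cesaro_mean ^^ M) R))"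
        by (rule continuous_on_subset[OF continuous_on_cesaro_mean]) (use N(1)[of M] Suc in auto)
      then show ?thesis using Suc by (auto intro: tail_integrable_continuous)
    qed (use R in simp)
    then show ?case by (rule cesaro_asymp.base) (use N(2) in simp)
  next
    case (step k)
    have "cesaro_asymp 0 (cesaro_mean ((cesaro_mean ^^ k) R)) L" using step.IH by simp
    then show ?case by (rule cesaro_asymp_of_cesaro_mean[rotated]) (rule N(1)[OF step.hyps(2)])
  qed
  from this[of 0] show ?thesis by simp
qed

section \<open>From Cesaro asymptotics to iterated means\<close>

text \<open>
  A class of functions stable under all averages from \<open>0\<close>. Boundedness is required on closed
  intervals starting at \<open>0\<close> because a mean of an unbounded integrable function need not be
  integrable.
\<close>

definition locally_tame :: "(real \<Rightarrow> complex) \<Rightarrow> bool" where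
  "locally_tame h \<longleftrightarrow> (\<forall>T>0. h integrable_on {0..T} \<and> (\<exists>M. \<forall>t\<in>{0..T}. norm (h t) \<le> M))"

lemma locally_tameI:
  assumes c: "continuous_on {0<..} h" and b: "\<And>T. T > 0 \<Longrightarrow> \<exists>M. \<forall>t\<in>{0..T}. norm (h t) \<le> M"
  shows "locally_tame h"
  unfolding locally_tame_def
proof (intro allI impI conjI b)
  fix T :: real assume T: "T > 0"
  obtain M where M: "\<And>t. t \<in> {0..T} \<Longrightarrow> norm (h t) \<le> M" using b[OF T] by blast
  have neg: "negligible {x \<in> {0..T} - {0<..T}. f x \<noteq> 0}" "negligible {x \<in> {0<..T} - {0..T}. f x \<noteq> 0}"
    for f :: "real \<Rightarrow> 'b::zero"
    by (rule negligible_subset[of "{0}"], simp, force)+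
  have "h integrable_on {0<..T}"
  proof (rule measurable_bounded_by_integrable_imp_integrable)
    show "h \<in> borel_measurable (lebesgue_on {0<..T})"
      by (intro continuous_imp_measurable_on_sets_lebesgue continuous_on_subset[OF c]) auto
    have "(\<lambda>t. M) integrable_on {0..T}" by (simp add: integrable_const_ivl)
    then show "(\<lambda>t. M) integrable_on {0<..T}" by (rule integrable_spike_set[OF _ neg])
  qed (use M in auto)
  then show "h integrable_on {0..T}" by (rule integrable_spike_set[OF _ neg(2,1)])
qed

lemma locally_tame_integrable: "locally_tame h \<Longrightarrow> t > 0 \<Longrightarrow> h integrable_on {0..t}"
  by (simp add: locally_tame_def)

lemma locally_tame_cesaro_mean:
  assumes h: "locally_tame h" shows "locally_tame (cesaro_mean h)"
proof (rule locally_tameI)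
  show "continuous_on {0<..} (cesaro_mean h)"
    by (intro continuous_on_cesaro_mean locally_tame_integrable h)
  fix T :: real assume T: "T > 0"
  obtain M where M: "\<And>t. t \<in> {0..T} \<Longrightarrow> norm (h t) \<le> M" using h T unfolding locally_tame_def by blast
  have "norm (cesaro_mean h t) \<le> M" if t: "t \<in> {0..T}" for t
  proof (cases "t = 0")
    case True
    have "0 \<le> M" using order_trans[OF norm_ge_zero M[of 0]] T by simp
    then show ?thesis using True by (simp add: cesaro_mean_def)
  next
    case False
    have "norm (integral {0..t} h) \<le> M * (t - 0)"
    proof -
      have i: "(h has_integral integral {0..t} h) (cbox 0 t)"
        using integrable_integral[OF locally_tame_integrable[OF h, of t]] t False by simp
      have "0 \<le> M" using order_trans[OF norm_ge_zero M[OF t]] .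
      then have "norm (integral {0..t} h) \<le> M * measure lborel (cbox 0 t)"
        by (rule has_integral_bound[OF _ i]) (rule M, use t in simp)
      then show ?thesis using t by simp
    qed
    moreover have "norm (cesaro_mean h t) = norm (integral {0..t} h) / t"
      using t by (simp add: cesaro_mean_def norm_divide)
    ultimately show ?thesis using False t by (simp add: pos_divide_le_eq)
  qed
  then show "\<exists>M. \<forall>t\<in>{0..T}. norm (cesaro_mean h t) \<le> M" by (intro exI ballI)
qed

lemma locally_tame_lincomb:
  assumes "locally_tame f" "locally_tame g"
  shows "locally_tame (\<lambda>t. c * f t + d * g t)"
  unfolding locally_tame_def
proof (intro allI impI conjI)
  fix T :: real assume T: "T > 0"
  show "(\<lambda>t. c * f t + d * g t) integrable_on {0..T}"
    using locally_tame_integrable[OF assms(1) T] locally_tame_integrable[OF assms(2) T]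
    by (intro integrable_add integrable_on_mult_right)
  obtain M where M: "\<And>t. t \<in> {0..T} \<Longrightarrow> norm (f t) \<le> M" using assms(1) T unfolding locally_tame_def by blast
  obtain N where N: "\<And>t. t \<in> {0..T} \<Longrightarrow> norm (g t) \<le> N" using assms(2) T unfolding locally_tame_def by blast
  show "\<exists>M. \<forall>t\<in>{0..T}. norm (c * f t + d * g t) \<le> M"
  proof (intro exI ballI)
    fix t assume t: "t \<in> {0..T}"
    show "norm (c * f t + d * g t) \<le> norm c * M + norm d * N"
      by (rule norm_triangle_le) (use M[OF t] N[OF t] in \<open>auto simp: norm_mult intro!: add_mono mult_left_mono\<close>)
  qed
qed

lemma cesaro_mean_lincomb:
  assumes "locally_tame f" "locally_tame g"
  shows "cesaro_mean (\<lambda>t. c * f t + d * g t) = (\<lambda>t. c * cesaro_mean f t + d * cesaro_mean g t)"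
proof
  fix t :: real
  show "cesaro_mean (\<lambda>t. c * f t + d * g t) t = c * cesaro_mean f t + d * cesaro_mean g t"
  proof (cases "t > 0")
    case True
    have i: "f integrable_on {0..t}" "g integrable_on {0..t}" using assms True locally_tame_integrable by blast+
    then show ?thesis
      by (simp add: cesaro_mean_def integral_add integrable_on_mult_right add_divide_distrib)
  next
    case False
    then show ?thesis by (cases "t = 0") (auto simp: cesaro_mean_def)
  qed
qed

lemma locally_tame_cesaro_mean_pow: "locally_tame h \<Longrightarrow> locally_tame ((cesaro_mean ^^ k) h)"
  by (induction k) (auto intro: locally_tame_cesaro_mean)

lemma cesaro_mean_pow_lincomb:
  assumes "locally_tame f" "locally_tame g"
  shows "(cesaro_mean ^^ k) (\<lambda>t. c * f t + d * g t) =
     (\<lambda>t. c * (cesaro_mean ^^ k) f t + d * (cesaro_mean ^^ k) g t)"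
  by (induction k) (simp_all add: cesaro_mean_lincomb locally_tame_cesaro_mean_pow assms)

lemma tendsto_cesaro_mean:
  assumes h: "locally_tame h" and lim: "(h \<longlongrightarrow> L) at_top"
  shows "(cesaro_mean h \<longlongrightarrow> L) at_top"
proof -
  have "tail_primitive h (\<lambda>t. integral {0..t} h)"
    by (intro tail_primitive_integral_from_0 locally_tame_integrable h)
  from primitive_growth[OF _ this, of 0] lim show ?thesis
    by (simp add: cesaro_mean_def[abs_def])
qed

fun iterated_integral :: "nat \<Rightarrow> (real \<Rightarrow> complex) \<Rightarrow> real \<Rightarrow> complex" where
  "iterated_integral 0 h t = h t"
| "iterated_integral (Suc k) h t = integral {0..t} (iterated_integral k h)"

text \<open>
  The Riesz mean of order \<open>k\<close>, normalised so that constants are fixed.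
\<close>

definition riesz_mean :: "nat \<Rightarrow> (real \<Rightarrow> complex) \<Rightarrow> real \<Rightarrow> complex" where
  "riesz_mean k h t = fact k * iterated_integral k h t / of_real t ^ k"

text \<open>
  The length \<open>N\<close> depends on the function alone and not on the chain of primitives, so the chain
  of iterated integrals from \<open>0\<close> may be used. The perturbation \<open>e\<close> absorbs, at each step of the
  induction, the difference between the given primitive and the one in the chain.
\<close>

lemma cesaro_asymp_chain:
  assumes "cesaro_asymp a h L"
  shows "\<exists>N. \<forall>G e. tail_integrable e \<longrightarrow> ((\<lambda>t. e t / of_real t ^ a) \<longlongrightarrow> 0) at_top \<longrightarrow>
     G 0 = (\<lambda>t. h t + e t) \<longrightarrow> (\<forall>i. tail_primitive (G i) (G (Suc i))) \<longrightarrow>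
     ((\<lambda>t. fact (a + N) / fact a * G N t / of_real t ^ (a + N)) \<longlongrightarrow> L) at_top"
  using assms
proof (induction rule: cesaro_asymp.induct)
  case (base h a L)
  show ?case
  proof (intro exI[of _ 0] allI impI)
    fix G :: "nat \<Rightarrow> real \<Rightarrow> complex" and e
    assume "((\<lambda>t. e t / of_real t ^ a) \<longlongrightarrow> 0) at_top" "G 0 = (\<lambda>t. h t + e t)"
    then show "((\<lambda>t. fact (a + 0) / fact a * G 0 t / of_real t ^ (a + 0)) \<longlongrightarrow> L) at_top"
      using tendsto_add[OF base(2), of _ 0] by (simp add: add_divide_distrib)
  qed
next
  case (step h H a L)
  obtain N where N: "\<forall>G e. tail_integrable e \<longrightarrow>
     ((\<lambda>t. e t / of_real t ^ Suc a) \<longlongrightarrow> 0) at_top \<longrightarrow>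
     G 0 = (\<lambda>t. H t + e t) \<longrightarrow> (\<forall>i. tail_primitive (G i) (G (Suc i))) \<longrightarrow>
     ((\<lambda>t. fact (Suc a + N) / fact (Suc a) * G N t / of_real t ^ (Suc a + N)) \<longlongrightarrow> L / of_nat (Suc a)) at_top"
    using step.IH by (elim exE)
  define c :: complex where "c = of_nat (Suc a)"
  have c: "c \<noteq> 0" by (simp only: c_def of_nat_eq_0_iff)
  have fc: "fact (Suc a) = c * fact a" by (simp only: c_def fact_Suc)
  have cancel: "c * (u / (c * v) * x / y) = u / v * x / y" for u v x y :: complex
    using c by (simp add: divide_simps)
  have eq: "c * (fact (Suc a + N) / fact (Suc a) * x / y) = fact (a + Suc N) / fact a * x / y" for x y :: complex
    unfolding fc add_Suc_right add_Suc by (rule cancel)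
  have cL: "c * (L / c) = L" using c by simp
  show ?case
  proof (intro exI[of _ "Suc N"] allI impI)
    fix G :: "nat \<Rightarrow> real \<Rightarrow> complex" and e
    assume e: "tail_integrable e" "((\<lambda>t. e t / of_real t ^ a) \<longlongrightarrow> 0) at_top"
      and G: "G 0 = (\<lambda>t. h t + e t)" "\<forall>i. tail_primitive (G i) (G (Suc i))"
    have "tail_primitive (G 0) (G 1)" using G(2) by simp
    from tail_primitive_diff[OF this step.hyps(1)]
    have P: "tail_primitive e (\<lambda>t. G 1 t - H t)" by (simp add: G(1))
    have "((\<lambda>t. fact (Suc a + N) / fact (Suc a) * G (Suc N) t / of_real t ^ (Suc a + N)) \<longlongrightarrow> L / of_nat (Suc a)) at_top"
    proof (rule N[rule_format, of "\<lambda>t. G 1 t - H t" "\<lambda>i. G (Suc i)"])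
      show "tail_integrable (\<lambda>t. G 1 t - H t)" by (rule tail_integrable_primitive[OF P])
      show "((\<lambda>t. (G 1 t - H t) / of_real t ^ Suc a) \<longlongrightarrow> 0) at_top"
        using primitive_growth[OF e(2) P] by (simp only: div_0)
    qed (use G(2) in auto)
    from tendsto_mult_left[OF this[folded c_def], of c]
    have "((\<lambda>t. fact (a + Suc N) / fact a * G (Suc N) t / of_real t ^ (Suc a + N)) \<longlongrightarrow> L) at_top"
      unfolding eq cL .
    then show "((\<lambda>t. fact (a + Suc N) / fact a * G (Suc N) t / of_real t ^ (a + Suc N)) \<longlongrightarrow> L) at_top"
      by (simp only: add_Suc add_Suc_right)
  qed
qed

lemma locally_tame_bound:
  assumes "locally_tame h" "T > 0"
  shows "\<exists>M\<ge>0. \<forall>t\<in>{0..T}. norm (h t) \<le> M"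
proof -
  obtain M where M: "\<And>t. t \<in> {0..T} \<Longrightarrow> norm (h t) \<le> M" using assms unfolding locally_tame_def by blast
  have "M \<ge> 0" using order_trans[OF norm_ge_zero M[of 0]] assms(2) by simp
  then show ?thesis using M by blast
qed

lemma norm_integral_from_0_le:
  assumes "h integrable_on {0..t}" "t \<ge> 0" "B \<ge> 0" "\<And>u. u \<in> {0..t} \<Longrightarrow> norm (h u) \<le> B"
  shows "norm (integral {0..t} h :: complex) \<le> B * t"
  using has_integral_bound[of B h "integral {0..t} h" 0 t] integrable_integral[OF assms(1)] assms by simp

lemma locally_tame_integral_from_0:
  assumes h: "locally_tame h" shows "locally_tame (\<lambda>t. integral {0..t} h)"
proof (rule locally_tameI)
  show "continuous_on {0<..} (\<lambda>t. integral {0..t} h)"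
    by (intro continuous_on_integral_from_0 locally_tame_integrable h)
  fix T :: real assume T: "T > 0"
  obtain M where M: "M \<ge> 0" "\<And>t. t \<in> {0..T} \<Longrightarrow> norm (h t) \<le> M" using locally_tame_bound[OF h T] by blast
  have "norm (integral {0..t} h) \<le> M * T" if t: "t \<in> {0..T}" for t
  proof -
    have "norm (integral {0..t} h) \<le> M * t"
      by (rule norm_integral_from_0_le)
        (use M t in \<open>auto intro: integrable_on_subinterval[OF locally_tame_integrable[OF h T]]\<close>)
    also have "\<dots> \<le> M * T" using M t by (intro mult_left_mono) auto
    finally show ?thesis .
  qed
  then show "\<exists>M. \<forall>t\<in>{0..T}. norm (integral {0..t} h) \<le> M" by (intro exI ballI)
qed

lemma iterated_integral_Suc_fun: "iterated_integral (Suc k) h = (\<lambda>t. integral {0..t} (iterated_integral k h))"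
  by (rule ext) simp

lemma locally_tame_iterated_integral: "locally_tame h \<Longrightarrow> locally_tame (iterated_integral k h)"
proof (induction k)
  case 0
  have "iterated_integral 0 h = h" by (rule ext) simp
  with 0 show ?case by simp
next
  case (Suc k)
  then show ?case unfolding iterated_integral_Suc_fun by (intro locally_tame_integral_from_0)
qed

lemma iterated_integral_bound:
  assumes h: "locally_tame h" and M: "M \<ge> 0" "\<And>t. t \<in> {0..T} \<Longrightarrow> norm (h t) \<le> M"
    and t: "t \<in> {0..T}"
  shows "norm (iterated_integral k h t) \<le> M * t ^ k"
  using t
proof (induction k arbitrary: t)
  case (Suc k)
  show ?case
  proof (cases "t = 0")
    case False
    then have t: "t > 0" using Suc.prems by simp
    have "norm (iterated_integral k h u) \<le> M * t ^ k" if "u \<in> {0..t}" for u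
    proof -
      have "norm (iterated_integral k h u) \<le> M * u ^ k" by (rule Suc.IH) (use that Suc.prems in auto)
      also have "\<dots> \<le> M * t ^ k" using that M by (intro mult_left_mono power_mono) auto
      finally show ?thesis .
    qed
    then have "norm (integral {0..t} (iterated_integral k h)) \<le> M * t ^ k * t"
      by (intro norm_integral_from_0_le locally_tame_integrable locally_tame_iterated_integral h)
        (use t M in auto)
    then show ?thesis by (simp add: mult_ac)
  qed simp
qed (use M in simp)

lemma continuous_on_riesz_mean:
  assumes h: "locally_tame h" shows "continuous_on {0<..} (riesz_mean (Suc k) h)"
proof -
  have "continuous_on {0<..} (iterated_integral (Suc k) h)"
    unfolding iterated_integral_Suc_fun
    by (intro continuous_on_integral_from_0 locally_tame_integrable locally_tame_iterated_integral h)
  then show ?thesis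
    unfolding riesz_mean_def[abs_def] by (intro continuous_intros) auto
qed

lemma locally_tame_riesz_mean:
  assumes h: "locally_tame h" shows "locally_tame (riesz_mean k h)"
proof (cases k)
  case 0
  have "riesz_mean 0 h = h" by (rule ext) (simp add: riesz_mean_def)
  then show ?thesis using 0 h by simp
next
  case (Suc j)
  show ?thesis
  proof (rule locally_tameI)
    show "continuous_on {0<..} (riesz_mean k h)" unfolding Suc by (rule continuous_on_riesz_mean[OF h])
    fix T :: real assume T: "T > 0"
    obtain M where M: "M \<ge> 0" "\<And>t. t \<in> {0..T} \<Longrightarrow> norm (h t) \<le> M" using locally_tame_bound[OF h T] by blast
    have "norm (riesz_mean k h t) \<le> fact k * M" if t: "t \<in> {0..T}" for t
    proof (cases "t = 0")
      case False
      have "fact k * norm (iterated_integral k h t) \<le> fact k * (M * t ^ k)"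
        by (intro mult_left_mono iterated_integral_bound[OF h M t]) auto
      then show ?thesis
        using False t by (simp add: riesz_mean_def norm_mult norm_divide norm_power pos_divide_le_eq mult_ac)
    qed (use Suc M in \<open>simp add: riesz_mean_def\<close>)
    then show "\<exists>M. \<forall>t\<in>{0..T}. norm (riesz_mean k h t) \<le> M" by (intro exI ballI)
  qed
qed

lemma iterated_integral_deriv:
  assumes h: "locally_tame h" and k: "k > 0" and t: "t > 0"
  shows "(iterated_integral (Suc k) h has_vector_derivative iterated_integral k h t) (at t)"
proof -
  obtain j where j: "k = Suc j" using k gr0_implies_Suc by blast
  have "continuous_on {0<..} (iterated_integral k h)"
    unfolding j iterated_integral_Suc_fun
    by (intro continuous_on_integral_from_0 locally_tame_integrable locally_tame_iterated_integral h)
  then have "isCont (iterated_integral k h) t"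
    using t continuous_on_eq_continuous_at[OF open_greaterThan] by auto
  then have c: "continuous (at t within {0..t+1} - {}) (iterated_integral k h)"
    by (rule continuous_at_imp_continuous_within)
  have "((\<lambda>u. integral {0..u} (iterated_integral k h)) has_vector_derivative iterated_integral k h t)
          (at t within {0..t+1})"
    using integral_has_vector_derivative_continuous_at[OF _ _ _ c] t
      locally_tame_integrable[OF locally_tame_iterated_integral[OF h], of "t+1" k] by simp
  then have "((\<lambda>u. integral {0..u} (iterated_integral k h)) has_vector_derivative iterated_integral k h t) (at t)"
    using at_within_interior[of t "{0..t+1}"] t by simp
  then show ?thesis unfolding iterated_integral_Suc_fun .
qed

text \<open>
  The link between Riesz and Hoelder means. Writing \<open>C_k\<close> for the Riesz mean, the derivative of
  \<open>t^(k+1) C_{k+1}\<close> is \<open>(k+1) t^k C_k\<close>, hence \<open>C_k = C_{k+1} + t C_{k+1}' / (k+1)\<close>; averaging this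
  equation and integrating by parts gives the claim.
\<close>

lemma cesaro_mean_riesz_mean:
  assumes h: "locally_tame h"
  shows "cesaro_mean (riesz_mean k h) =
    (\<lambda>t. 1 / of_nat (Suc k) * riesz_mean (Suc k) h t
        + of_nat k / of_nat (Suc k) * cesaro_mean (riesz_mean (Suc k) h) t)"
proof
  fix t :: real
  show "cesaro_mean (riesz_mean k h) t =
    1 / of_nat (Suc k) * riesz_mean (Suc k) h t
        + of_nat k / of_nat (Suc k) * cesaro_mean (riesz_mean (Suc k) h) t"
  proof (cases "t > 0 \<and> k > 0")
    case True
    then have t: "t > 0" and k: "k > 0" by auto
    \<comment> \<open>\<open>U\<close> is \<open>u C_{k+1}(u) / (k + 1)\<close>; in this form its derivative is visible, and so is \<open>U 0 = 0\<close> since \<open>k > 0\<close>\<close>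
    define U where "U u = fact k * (of_real (inverse (u ^ k)) * iterated_integral (Suc k) h u)" for u :: real
    have eqU: "U u = of_real u * (1 / of_nat (Suc k) * riesz_mean (Suc k) h u)" for u
    proof (cases "u = 0")
      case False
      have "F * (inverse y * K) = x * (1 / n * (n * F * K / (x * y)))"
        if "x \<noteq> 0" "n \<noteq> 0" for F y K x n :: complex
        using that by (simp add: field_simps)
      from this[where x = "of_real u" and n = "of_nat (Suc k)"] show ?thesis
        using False unfolding U_def riesz_mean_def fact_Suc power_Suc
        by (simp only: of_real_inverse of_real_power of_nat_eq_0_iff of_real_eq_0_iff) blast
    qed (use k in \<open>simp add: U_def\<close>)
    obtain M where M: "M \<ge> 0" "\<And>u. u \<in> {0..t} \<Longrightarrow> norm (h u) \<le> M" using locally_tame_bound[OF h t] by blast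
    \<comment> \<open>right-continuity at \<open>0\<close> comes from the bound \<open>O(u)\<close>, as the Riesz mean is merely bounded there\<close>
    have "continuous_on {0..t} U"
      unfolding continuous_on_eq_continuous_within
    proof
      fix x assume x: "x \<in> {0..t}"
      show "continuous (at x within {0..t}) U"
      proof (cases "x = 0")
        case False
        have "continuous_on {0<..} (\<lambda>u. of_real u * (1 / of_nat (Suc k) * riesz_mean (Suc k) h u))"
          by (intro continuous_intros continuous_on_riesz_mean h)
        then have "isCont U x" unfolding eqU[symmetric]
          using False x by (intro continuous_on_interior[of "{0<..}" U x]) (simp_all add: interior_open less_le)
        then show ?thesis by (rule continuous_at_imp_continuous_within)
      next
        case True
        have le: "norm (U u) \<le> fact k * M * u" if u: "u \<in> {0..t}" for u
        proof (cases "u = 0")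
          case False
          have "norm (iterated_integral (Suc k) h u) \<le> M * u ^ Suc k"
            by (rule iterated_integral_bound[OF h M u])
          then have "fact k * (inverse (u ^ k) * norm (iterated_integral (Suc k) h u))
              \<le> fact k * (inverse (u ^ k) * (M * u ^ Suc k))"
            using u by (intro mult_left_mono) auto
          also have "\<dots> = fact k * M * u" using False by simp
          finally show ?thesis using u
            by (simp add: U_def norm_mult norm_inverse norm_power del: iterated_integral.simps)
        qed (use k in \<open>simp add: U_def\<close>)
        have "((\<lambda>u. U u) \<longlongrightarrow> 0) (at 0 within {0..t})"
        proof (rule Lim_null_comparison)
          show "\<forall>\<^sub>F u in at 0 within {0..t}. norm (U u) \<le> fact k * M * u"
            unfolding eventually_at_filter by (intro always_eventually) (use le in auto)
          show "((\<lambda>u. fact k * M * u) \<longlongrightarrow> 0) (at 0 within {0..t})"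
            by (auto intro!: tendsto_eq_intros)
        qed
        moreover have "U 0 = 0" by (simp add: eqU)
        ultimately show ?thesis unfolding continuous_within True by simp
      qed
    qed
    moreover have "(U has_vector_derivative (riesz_mean k h u - of_nat k / of_nat (Suc k) * riesz_mean (Suc k) h u)) (at u)"
      if u: "u \<in> {0<..<t}" for u
    proof -
      have "((\<lambda>u. inverse (u ^ k)) has_real_derivative (- of_nat k * inverse (u ^ Suc k))) (at u)"
      proof -
        obtain j where j: "k = Suc j" using k gr0_implies_Suc by blast
        have "m * p * inverse ((u * p) ^ Suc (Suc 0)) = m * inverse (u * (u * p))"
          if "p \<noteq> 0" for m p :: real
          using u that by (simp add: field_simps)
        from this[of "u ^ j" "real (Suc j)"]
        have eq: "real (Suc j) * u ^ (Suc j - Suc 0) * inverse ((u ^ Suc j) ^ Suc (Suc 0))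
            = real (Suc j) * inverse (u ^ Suc (Suc j))"
          using u by (simp del: of_nat_Suc)
        have "((\<lambda>u. inverse (u ^ Suc j)) has_real_derivative
            - (real (Suc j) * u ^ (Suc j - Suc 0) * inverse ((u ^ Suc j) ^ Suc (Suc 0)))) (at u)"
          by (rule DERIV_inverse_fun[OF DERIV_pow]) (use u in simp)
        then show ?thesis unfolding eq j by (simp only: mult_minus_left)
      qed
      from has_vector_derivative_mult[OF has_vector_derivative_of_real[OF this]
          iterated_integral_deriv[OF h k, of u]] u
      have "(U has_vector_derivative (fact k * (of_real (inverse (u ^ k)) * iterated_integral k h u
           + of_real (- of_nat k * inverse (u ^ Suc k)) * iterated_integral (Suc k) h u))) (at u)"
        unfolding U_def by (auto intro!: derivative_intros)
      also have "fact k * (of_real (inverse (u ^ k)) * iterated_integral k h u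
           + of_real (- of_nat k * inverse (u ^ Suc k)) * iterated_integral (Suc k) h u) =
         riesz_mean k h u - of_nat k / of_nat (Suc k) * riesz_mean (Suc k) h u"
      proof -
        have "F * (inverse y * K + (- m * inverse (x * y)) * K') = F * K / y - m / n * (n * F * K' / (x * y))"
          if "n \<noteq> 0" for F y K K' x n m :: complex
          using that by (simp add: field_simps)
        from this[where n = "of_nat (Suc k)"] show ?thesis
          unfolding riesz_mean_def fact_Suc power_Suc of_real_mult of_real_minus of_real_of_nat_eq
            of_real_inverse of_real_power
          by (simp only: of_nat_eq_0_iff)
      qed
      finally show ?thesis .
    qed
    ultimately have "((\<lambda>u. riesz_mean k h u - of_nat k / of_nat (Suc k) * riesz_mean (Suc k) h u)
       has_integral (U t - U 0)) {0..t}"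
      using t by (intro fundamental_theorem_of_calculus_interior) auto
    then have "integral {0..t} (\<lambda>u. riesz_mean k h u - of_nat k / of_nat (Suc k) * riesz_mean (Suc k) h u) = U t - U 0"
      by (rule integral_unique)
    moreover have "integral {0..t} (\<lambda>u. riesz_mean k h u - of_nat k / of_nat (Suc k) * riesz_mean (Suc k) h u) =
      integral {0..t} (riesz_mean k h) - of_nat k / of_nat (Suc k) * integral {0..t} (riesz_mean (Suc k) h)"
      using locally_tame_integrable[OF locally_tame_riesz_mean[OF h] t]
      by (simp add: integral_diff integrable_on_mult_right del: of_nat_Suc)
    ultimately have "integral {0..t} (riesz_mean k h) = of_real t * (1 / of_nat (Suc k) * riesz_mean (Suc k) h t)
       + of_nat k / of_nat (Suc k) * integral {0..t} (riesz_mean (Suc k) h)"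
      unfolding eqU by (simp add: algebra_simps del: of_nat_Suc)
    then show ?thesis using t by (simp add: cesaro_mean_def add_divide_distrib del: of_nat_Suc)
  next
    case False
    have "iterated_integral 0 h = h" by (rule ext) simp
    then show ?thesis using False
      by (cases "t = 0"; cases "k = 0") (auto simp: cesaro_mean_def riesz_mean_def[abs_def])
  qed
qed

text \<open>
  With \<open>P\<close> the averaging operator and \<open>C_k\<close> the Riesz mean of order \<open>k\<close>, the convergence of \<open>C_N\<close> is carried
  downwards in \<open>k\<close> to \<open>P^(N-k) C_k\<close>: by the previous identity \<open>P^(N-k) C_k\<close> is a convex combination of \<open>P^(N-k-1) C_{k+1}\<close>
  and its average. At \<open>k = 0\<close> this is the convergence of \<open>P^N h\<close>.
\<close>

lemma cesaro_asymp_imp_has_cesaro_limit: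
  assumes c: "cesaro_asymp 0 h L" and h: "locally_tame h"
  shows "has_cesaro_limit h L"
proof -
  obtain N where N: "\<forall>G e. tail_integrable e \<longrightarrow> ((\<lambda>t. e t / of_real t ^ 0) \<longlongrightarrow> 0) at_top \<longrightarrow>
     G 0 = (\<lambda>t. h t + e t) \<longrightarrow> (\<forall>i. tail_primitive (G i) (G (Suc i))) \<longrightarrow>
     ((\<lambda>t. fact (0 + N) / fact 0 * G N t / of_real t ^ (0 + N)) \<longlongrightarrow> L) at_top"
    using cesaro_asymp_chain[OF c] by (elim exE)
  have "((\<lambda>t. fact (0 + N) / fact 0 * iterated_integral N h t / of_real t ^ (0 + N)) \<longlongrightarrow> L) at_top"
  proof (rule N[rule_format, of "\<lambda>t. 0" "\<lambda>i. iterated_integral i h"])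
    show "tail_primitive (iterated_integral i h) (iterated_integral (Suc i) h)" for i
      unfolding iterated_integral_Suc_fun
      by (intro tail_primitive_integral_from_0 locally_tame_integrable locally_tame_iterated_integral h)
    show "tail_integrable (\<lambda>t. 0)" by (rule tail_integrable_continuous[of 0]) (rule continuous_intros)
  qed auto
  then have lim: "(riesz_mean N h \<longlongrightarrow> L) at_top" by (simp add: riesz_mean_def[abs_def])
  have "((cesaro_mean ^^ (N - k)) (riesz_mean k h) \<longlongrightarrow> L) at_top" if "k \<le> N" for k
    using that
  proof (induction rule: inc_induct)
    case base
    then show ?case using lim by simp
  next
    case (step k)
    let ?X = "(cesaro_mean ^^ (N - Suc k)) (riesz_mean (Suc k) h)"
    have "(cesaro_mean ^^ (N - k)) (riesz_mean k h) = (cesaro_mean ^^ (N - Suc k)) (cesaro_mean (riesz_mean k h))"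
      using step.hyps by (simp only: Suc_diff_Suc[symmetric] funpow_Suc_right o_def)
    also have "\<dots> = (\<lambda>t. 1 / of_nat (Suc k) * ?X t + of_nat k / of_nat (Suc k) *
        (cesaro_mean ^^ (N - Suc k)) (cesaro_mean (riesz_mean (Suc k) h)) t)"
      by (subst cesaro_mean_riesz_mean[OF h, of k])
         (intro cesaro_mean_pow_lincomb locally_tame_cesaro_mean locally_tame_riesz_mean h)
    also have "(cesaro_mean ^^ (N - Suc k)) (cesaro_mean (riesz_mean (Suc k) h)) = cesaro_mean ?X"
      by (rule funpow_swap1[symmetric])
    finally have eq: "(cesaro_mean ^^ (N - k)) (riesz_mean k h) =
      (\<lambda>t. 1 / of_nat (Suc k) * ?X t + of_nat k / of_nat (Suc k) * cesaro_mean ?X t)" .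
    have "((\<lambda>t. 1 / of_nat (Suc k) * ?X t + of_nat k / of_nat (Suc k) * cesaro_mean ?X t) \<longlongrightarrow>
        1 / of_nat (Suc k) * L + of_nat k / of_nat (Suc k) * L) at_top"
      by (intro tendsto_intros tendsto_cesaro_mean step.IH locally_tame_cesaro_mean_pow locally_tame_riesz_mean h)
    also have "1 / of_nat (Suc k) * L + of_nat k / of_nat (Suc k) * L = L"
    proof -
      have "of_nat (Suc k) \<noteq> (0::complex)" by (simp only: of_nat_eq_0_iff)
      then show ?thesis
        by (simp only: distrib_right[symmetric] add_divide_distrib[symmetric] of_nat_Suc divide_self
            mult_1_left not_False_eq_True simp_thms)
    qed
    finally show ?case unfolding eq .
  qed
  from this[of 0] have "((cesaro_mean ^^ N) (riesz_mean 0 h) \<longlongrightarrow> L) at_top" by simp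
  moreover have "riesz_mean 0 h = h" by (rule ext) (simp add: riesz_mean_def)
  ultimately show ?thesis
    unfolding has_cesaro_limit_def
    using locally_tame_integrable[OF locally_tame_cesaro_mean_pow[OF h]] by auto
qed

section \<open>Sums of powers and logarithms with a Cesaro limit\<close>

lemma cesaro_asymp_raise:
  assumes "cesaro_asymp a g L" shows "cesaro_asymp (Suc a) g 0"
  using assms
proof (induction rule: cesaro_asymp.induct)
  case (base g a L)
  have "((\<lambda>t. (g t / of_real t ^ a) * (1 / of_real t)) \<longlongrightarrow> L * 0) at_top"
    by (intro tendsto_mult base(2) tendsto_divide_0[OF tendsto_const] filterlim_of_real_at_infinity)
  then show ?case by (intro cesaro_asymp.base base(1)) (simp add: mult.commute)
next
  case (step g G a L)
  show ?case by (rule cesaro_asymp.step[OF step.hyps(1)]) (use step.IH in simp)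
qed

lemma tail_primitive_contour:
  assumes "\<And>w. Re w > 0 \<Longrightarrow> (f has_field_derivative f' w) (at w)"
  shows "tail_primitive (\<lambda>t. f' (z + of_real t)) (\<lambda>t. f (z + of_real t))"
proof (rule tail_primitive_deriv[of "1 - Re z"])
  fix t assume t: "1 - Re z \<le> t"
  have "((\<lambda>t. z + of_real t) has_vector_derivative 1) (at t)"
    by (auto intro!: derivative_eq_intros)
  moreover have "(f has_field_derivative f' (z + of_real t)) (at (z + of_real t))"
    by (rule assms) (use t in simp)
  ultimately show "((\<lambda>t. f (z + of_real t)) has_vector_derivative f' (z + of_real t)) (at t)"
    using field_vector_diff_chain_at by (fastforce simp: o_def)
qed

text \<open>
  Polynomials in the logarithm, instead of single powers of it, make these functions stable under
  the Euler operator \<open>w d/dw\<close>.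
\<close>

definition power_log_sum :: "nat set \<Rightarrow> (nat \<Rightarrow> complex) \<Rightarrow> (nat \<Rightarrow> complex poly) \<Rightarrow> complex \<Rightarrow> complex" where
  "power_log_sum I \<rho> p w = (\<Sum>i\<in>I. w powr \<rho> i * poly (p i) (Ln w))"

lemma power_log_sum_deriv:
  assumes "Re w > 0"
  shows "((\<lambda>w. w * power_log_sum I \<rho> p w) has_field_derivative
           power_log_sum I \<rho> (\<lambda>i. smult (1 + \<rho> i) (p i) + pderiv (p i)) w) (at w)"
proof -
  have w: "w \<notin> \<real>\<^sub>\<le>\<^sub>0" "w \<noteq> 0" using assms by (auto simp: complex_nonpos_Reals_iff)
  have "((\<lambda>w. w * (w powr \<rho> i * poly (p i) (Ln w))) has_field_derivative
          w powr \<rho> i * poly (smult (1 + \<rho> i) (p i) + pderiv (p i)) (Ln w)) (at w)" for i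
  proof -
    have L: "(Ln has_field_derivative inverse w) (at w)"
      by (rule has_field_derivative_Ln[OF w(1)])
    have P: "((\<lambda>w. poly (p i) (Ln w)) has_field_derivative poly (pderiv (p i)) (Ln w) * inverse w) (at w)"
      by (rule DERIV_chain2[OF poly_DERIV L])
    have "w powr \<rho> i = w * w powr (\<rho> i - 1)" using w(2) by (simp add: powr_diff)
    then show ?thesis
      by (intro DERIV_cong[OF DERIV_mult[OF DERIV_ident
            DERIV_mult[OF has_field_derivative_powr[OF w(1), of "\<rho> i"] P]]])
         (simp add: field_simps w(2))
  qed
  then show ?thesis
    unfolding power_log_sum_def sum_distrib_left by (intro DERIV_sum)
qed

text \<open>
  The operator \<open>\<theta> - \<sigma>\<close> with \<open>\<theta> = w d/dw\<close>, applied on both sides. Since \<open>\<theta> g = (w g)' - g\<close>, the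
  operator \<open>\<theta>\<close> turns a function with a Cesaro limit into one with Cesaro limit \<open>0\<close>, so \<open>\<theta> - \<sigma>\<close>
  multiplies the limit by \<open>- \<sigma>\<close>.
\<close>

lemma cesaro_asymp_power_log_sum_step:
  assumes "cesaro_asymp 0 (\<lambda>t. power_log_sum I \<rho> p (z + of_real t)) d"
  shows "cesaro_asymp 0 (\<lambda>t. power_log_sum I \<rho> (\<lambda>i. smult (\<rho> i - \<sigma>) (p i) + pderiv (p i)) (z + of_real t)) (- \<sigma> * d)"
proof -
  let ?g = "\<lambda>t. power_log_sum I \<rho> p (z + of_real t)"
  have "continuous_on {1 - Re z..} ?g"
  proof -
    have r: "z + of_real t \<notin> \<real>\<^sub>\<le>\<^sub>0" if "t \<in> {1 - Re z..}" for t
      using that by (auto simp: complex_nonpos_Reals_iff)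
    then have "z + of_real t \<noteq> 0" if "t \<in> {1 - Re z..}" for t
      using that by (auto simp: complex_eq_iff)
    then show ?thesis
      unfolding power_log_sum_def
      by (intro continuous_intros continuous_on_powr_complex) (use r in \<open>auto simp: complex_nonpos_Reals_iff\<close>)
  qed
  then have "cesaro_asymp (Suc 0) (\<lambda>t. of_real t * ?g t) d"
    by (intro cesaro_asymp_mult_ident[OF assms] exI)
  from cesaro_asymp_add[OF this cesaro_asymp_cmult[OF cesaro_asymp_raise[OF assms], of z]]
  have "cesaro_asymp (Suc 0) (\<lambda>t. (z + of_real t) * ?g t) (d / of_nat (Suc 0))"
    by (simp add: algebra_simps)
  then have "cesaro_asymp 0 (\<lambda>t. power_log_sum I \<rho> (\<lambda>i. smult (1 + \<rho> i) (p i) + pderiv (p i)) (z + of_real t)) d"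
    by (rule cesaro_asymp.step[rotated])
       (rule tail_primitive_contour[where f = "\<lambda>w. w * power_log_sum I \<rho> p w"
          and f' = "power_log_sum I \<rho> (\<lambda>i. smult (1 + \<rho> i) (p i) + pderiv (p i))"],
        rule power_log_sum_deriv)
  from cesaro_asymp_diff[OF this cesaro_asymp_cmult[OF assms, of "1 + \<sigma>"]]
  show ?thesis
    by (simp add: power_log_sum_def sum_distrib_left sum_subtractf[symmetric] algebra_simps)
qed

lemma pderiv_pow_eq_0: "degree p < n \<Longrightarrow> (pderiv ^^ n) (p :: complex poly) = 0"
proof (induction n arbitrary: p)
  case (Suc n)
  have z: "(pderiv ^^ n) (0 :: complex poly) = 0" by (induction n) auto
  show ?case
  proof (cases "degree p = 0")
    case True
    then have "pderiv p = 0" by (simp add: pderiv_eq_0_iff)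
    then show ?thesis using z by (simp add: funpow_swap1)
  next
    case False
    then have "(pderiv ^^ n) (pderiv p) = 0" using Suc.prems by (intro Suc.IH) (simp add: degree_pderiv)
    then show ?thesis by (simp add: funpow_swap1)
  qed
qed simp

text \<open>
  A suitable product of factors \<open>\<theta> - \<rho> i\<close> annihilates the sum, while it multiplies the limit by a
  product of the numbers \<open>- \<rho> i \<noteq> 0\<close>. No asymptotic comparison of the terms is needed, so purely
  oscillating powers with \<open>Re (\<rho> i) = 0\<close> require no special treatment.
\<close>

lemma cesaro_asymp_power_log_sum_eq_0:
  assumes "finite I" "\<And>i. i \<in> I \<Longrightarrow> \<rho> i \<noteq> 0"
    and "cesaro_asymp 0 (\<lambda>t. power_log_sum I \<rho> p (z + of_real t)) d"
  shows "d = 0"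
  using assms
proof (induction I arbitrary: p d rule: finite_induct)
  case empty
  then show ?case using cesaro_asymp_limit_unique[of 0 "\<lambda>_. 0" d 0] by (simp add: power_log_sum_def)
next
  case (insert j I)
  \<comment> \<open>inner induction: each factor \<open>\<theta> - \<rho> j\<close> differentiates the polynomial \<open>p j\<close> once, until the term is gone\<close>
  have "d = 0"
    if "(pderiv ^^ n) (p j) = 0" "cesaro_asymp 0 (\<lambda>t. power_log_sum (insert j I) \<rho> p (z + of_real t)) d"
    for n p d
    using that
  proof (induction n arbitrary: p d)
    case 0
    then have "cesaro_asymp 0 (\<lambda>t. power_log_sum I \<rho> p (z + of_real t)) d"
      using insert.hyps by (simp add: power_log_sum_def)
    then show ?case using insert.IH insert.prems(1) by blast
  next
    case (Suc n)
    have "- \<rho> j * d = 0"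
      by (rule Suc.IH[OF _ cesaro_asymp_power_log_sum_step[OF Suc.prems(2), of "\<rho> j"]])
         (use Suc.prems(1) in \<open>simp add: funpow_swap1\<close>)
    then show ?case using insert.prems(1)[of j] by simp
  qed
  from this[OF pderiv_pow_eq_0[OF lessI] insert.prems(2)] show ?case .
qed

section \<open>Periodic functions of mean zero times a power\<close>

text \<open>
  The periodised Bernoulli polynomials have these properties, but the only thing that matters is
  that the class contains a primitive of each of its members. Jumps are allowed at the integers,
  for the sake of the sawtooth function at the start of the sequence.
\<close>

definition mean_zero_periodic :: "(real \<Rightarrow> complex) \<Rightarrow> bool" where
  "mean_zero_periodic p \<longleftrightarrow> (\<forall>t\<ge>0. p (t + 1) = p t) \<and> (\<forall>t>0. t \<notin> \<int> \<longrightarrow> isCont p t) \<and>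
     locally_tame p \<and> integral {0..1} p = 0"

lemma periodic_frac:
  assumes "\<And>t. t \<ge> 0 \<Longrightarrow> p (t + 1) = p t" "t \<ge> (0::real)"
  shows "p t = p (frac t)"
proof -
  have "p (u + of_nat n) = p u" if "u \<ge> 0" for u n
  proof (induction n)
    case (Suc n)
    have "p (u + of_nat n + 1) = p (u + of_nat n)" by (rule assms(1)) (use that in simp)
    then show ?case using Suc by (simp add: algebra_simps)
  qed simp
  from this[of "frac t" "nat \<lfloor>t\<rfloor>"] show ?thesis
    using assms(2) by (simp add: frac_def)
qed

lemma mean_zero_periodic_bounded:
  assumes "mean_zero_periodic p"
  obtains B where "B \<ge> 0" "\<And>t. t \<ge> 0 \<Longrightarrow> norm (p t) \<le> B"
proof -
  have "locally_tame p" and per: "\<And>t. t \<ge> 0 \<Longrightarrow> p (t + 1) = p t"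
    using assms unfolding mean_zero_periodic_def by auto
  then obtain B where B: "B \<ge> 0" "\<And>t. t \<in> {0..1} \<Longrightarrow> norm (p t) \<le> B"
    using locally_tame_bound[of p 1] by (metis zero_less_one)
  have "norm (p t) \<le> B" if "t \<ge> 0" for t
  proof -
    have "norm (p (frac t)) \<le> B" by (rule B(2)) (use frac_ge_0[of t] frac_lt_1[of t] in auto)
    then show ?thesis using periodic_frac[of p t, OF per that] by simp
  qed
  then show ?thesis using that B by blast
qed

text \<open>
  The mean value zero of \<open>p\<close> makes the primitive periodic; its additive constant is then chosen to
  make its own mean value vanish.
\<close>

lemma mean_zero_periodic_primitive:
  assumes p: "mean_zero_periodic p"
  obtains q where "mean_zero_periodic q" "continuous_on {0..} q"
    "\<And>t. t > 0 \<Longrightarrow> t \<notin> \<int> \<Longrightarrow> (q has_vector_derivative p t) (at t)"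
proof -
  have tame: "locally_tame p" and per: "\<And>t. t \<ge> 0 \<Longrightarrow> p (t + 1) = p t"
    and cont: "\<And>t. t > 0 \<Longrightarrow> t \<notin> \<int> \<Longrightarrow> isCont p t" and zero: "integral {0..1} p = 0"
    using p unfolding mean_zero_periodic_def by auto
  have int: "p integrable_on {0..t}" for t
    by (rule integrable_on_subinterval[OF locally_tame_integrable[OF tame, of "max t 1"]]) auto
  define r where "r t = integral {0..t} p" for t
  have contr: "continuous_on {0..T} r" for T
    unfolding r_def by (rule indefinite_integral_continuous_1[OF int])
  define c where "c = integral {0..1} r"
  define q where "q t = r t - c" for t
  have contq: "continuous_on {0..T} q" for T unfolding q_def by (intro continuous_intros contr)
  have "continuous_on {0..} q"
    unfolding continuous_on_eq_continuous_within
  proof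
    fix t :: real assume t: "t \<in> {0..}"
    have "continuous (at t within {0..t+1}) q"
      using contq[of "t+1"] t unfolding continuous_on_eq_continuous_within by auto
    moreover have "at t within {0..t+1} = at t within {0..}"
      by (rule at_within_nhd[of _ "{..<t+1}"]) auto
    ultimately show "continuous (at t within {0..}) q" by simp
  qed
  moreover have deriv: "(q has_vector_derivative p t) (at t)" if t: "t > 0" "t \<notin> \<int>" for t
  proof -
    have c: "continuous (at t within {0..t+1} - {}) p"
      by (rule continuous_at_imp_continuous_within[OF cont[OF t]])
    have "(r has_vector_derivative p t) (at t within {0..t+1})"
      using integral_has_vector_derivative_continuous_at[OF int _ _ c] t unfolding r_def by simp
    then have "(r has_vector_derivative p t) (at t)"
      using at_within_interior[of t "{0..t+1}"] t by simp
    then show ?thesis unfolding q_def by (auto intro!: derivative_eq_intros)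
  qed
  moreover have "mean_zero_periodic q"
    unfolding mean_zero_periodic_def
  proof (intro conjI allI impI)
    fix t :: real assume t: "t \<ge> 0"
    have "integral {0..1} p + integral {1..t+1} p = integral {0..t+1} p"
      using t by (intro Henstock_Kurzweil_Integration.integral_combine int) auto
    moreover have "integral {1..t+1} p = integral {0..t} p"
    proof -
      have "(p has_integral integral {0..t} p) (cbox 0 t)" using int by (simp add: integrable_integral)
      from has_integral_affinity'[OF this, of 1 "-1"]
      have "((\<lambda>x. p (x - 1)) has_integral integral {0..t} p) {1..t+1}" by simp
      then have "(p has_integral integral {0..t} p) {1..t+1}"
        by (rule has_integral_eq[rotated]) (use per[of "_ - 1"] in simp)
      then show ?thesis by (rule integral_unique)
    qed
    ultimately show "q (t + 1) = q t" by (simp add: q_def r_def zero)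
  next
    fix t :: real assume "t > 0" "t \<notin> \<int>"
    then show "isCont q t" using deriv has_vector_derivative_continuous by blast
  next
    show "locally_tame q"
      unfolding locally_tame_def
    proof (intro allI impI conjI)
      fix T :: real
      show "q integrable_on {0..T}" by (rule integrable_continuous_interval[OF contq])
      have "bounded (q ` {0..T})" by (intro compact_imp_bounded compact_continuous_image contq compact_Icc)
      then show "\<exists>M. \<forall>t\<in>{0..T}. norm (q t) \<le> M" unfolding bounded_iff by blast
    qed
  next
    have "integral {0..1} q = integral {0..1} r - integral {0..1} (\<lambda>t::real. c)"
      unfolding q_def by (intro integral_diff integrable_continuous_interval contr) auto
    then show "integral {0..1} q = 0" by (simp add: c_def)
  qed
  ultimately show ?thesis using that by blast
qed

lemma norm_powr_le:
  "norm (w powr \<rho>) \<le> norm w powr Re \<rho> * exp (pi * \<bar>Im \<rho>\<bar>)"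
proof (cases "w = 0")
  case False
  have "norm (w powr \<rho>) = exp (Re \<rho> * ln (norm w) - Im \<rho> * Im (Ln w))"
    using False by (simp add: powr_def)
  also have "\<dots> = norm w powr Re \<rho> * exp (- Im \<rho> * Im (Ln w))"
    using False by (simp add: powr_def exp_diff exp_minus divide_inverse)
  also have "\<dots> \<le> norm w powr Re \<rho> * exp (pi * \<bar>Im \<rho>\<bar>)"
  proof -
    have "\<bar>Im (Ln w)\<bar> \<le> pi" using mpi_less_Im_Ln[OF False] Im_Ln_le_pi[OF False] by linarith
    then have "\<bar>Im \<rho>\<bar> * \<bar>Im (Ln w)\<bar> \<le> \<bar>Im \<rho>\<bar> * pi" by (intro mult_left_mono) auto
    then have "- Im \<rho> * Im (Ln w) \<le> pi * \<bar>Im \<rho>\<bar>"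
      using abs_ge_self[of "- Im \<rho> * Im (Ln w)"] by (simp add: abs_mult mult.commute)
    then show ?thesis by (intro mult_left_mono) auto
  qed
  finally show ?thesis .
qed simp

lemma contour_powr_bound:
  obtains C where "C > 0" "\<And>t. t \<ge> 2 * norm z + 1 \<Longrightarrow> norm ((z + of_real t) powr \<rho>) \<le> C * t powr Re \<rho>"
proof
  define \<sigma> where "\<sigma> = Re \<rho>"
  show "2 powr \<bar>\<sigma>\<bar> * exp (pi * \<bar>Im \<rho>\<bar>) > 0" by simp
  fix t assume t: "t \<ge> 2 * norm z + 1"
  have t0: "t > 0" using t norm_ge_zero[of z] by linarith
  have nt: "norm (of_real t :: complex) = t" using t0 by simp
  have up: "norm (z + of_real t) \<le> 2 * t"
    using norm_triangle_ineq[of z "of_real t"] t norm_ge_zero[of z] nt by linarith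
  have lo: "t / 2 \<le> norm (z + of_real t)"
    using norm_diff_ineq[of "of_real t" z] t nt by (simp add: add.commute)
  have "norm (z + of_real t) powr \<sigma> \<le> 2 powr \<bar>\<sigma>\<bar> * t powr \<sigma>"
  proof (cases "\<sigma> \<ge> 0")
    case True
    have "norm (z + of_real t) powr \<sigma> \<le> (2 * t) powr \<sigma>" using up True by (intro powr_mono2) auto
    then show ?thesis using True t0 by (simp add: powr_mult)
  next
    case False
    have "norm (z + of_real t) powr \<sigma> \<le> (t / 2) powr \<sigma>" using lo False t0 by (intro powr_mono2') auto
    also have "(t / 2) powr \<sigma> = 2 powr (- \<sigma>) * t powr \<sigma>"
      using t0 by (simp add: powr_divide powr_minus_divide)
    finally show ?thesis using False by simp
  qed
  then have "norm (z + of_real t) powr \<sigma> * exp (pi * \<bar>Im \<rho>\<bar>) \<le> 2 powr \<bar>\<sigma>\<bar> * t powr \<sigma> * exp (pi * \<bar>Im \<rho>\<bar>)"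
    by (intro mult_right_mono) auto
  then show "norm ((z + of_real t) powr \<rho>) \<le> 2 powr \<bar>\<sigma>\<bar> * exp (pi * \<bar>Im \<rho>\<bar>) * t powr Re \<rho>"
    using order_trans[OF norm_powr_le[of "z + of_real t" \<rho>], folded \<sigma>_def]
    unfolding \<sigma>_def[symmetric] by (simp only: mult_ac)
qed

text \<open>
  One step of the Euler-Maclaurin expansion: integration by parts trades \<open>p\<close> for its periodic
  primitive and lowers the exponent of the power.
\<close>

lemma tail_primitive_periodic_parts:
  assumes q: "continuous_on {0..} q"
    and deriv: "\<And>t. t > 0 \<Longrightarrow> t \<notin> \<int> \<Longrightarrow> (q has_vector_derivative p t) (at t)"
  shows "tail_primitive (\<lambda>t. p t * (z + of_real t) powr \<rho> + \<rho> * (q t * (z + of_real t) powr (\<rho> - 1)))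
           (\<lambda>t. q t * (z + of_real t) powr \<rho>)"
proof (rule tail_primitive_from_base)
  define T where "T = max 1 (1 - Re z)"
  fix t assume t: "T \<le> t"
  have T: "T > 0" by (simp add: T_def)
  have r: "z + of_real u \<notin> \<real>\<^sub>\<le>\<^sub>0" "z + of_real u \<noteq> 0" if "u \<ge> T" for u
    using that by (auto simp: T_def complex_nonpos_Reals_iff complex_eq_iff)
  show "((\<lambda>t. p t * (z + of_real t) powr \<rho> + \<rho> * (q t * (z + of_real t) powr (\<rho> - 1))) has_integral
     q t * (z + of_real t) powr \<rho> - q T * (z + of_real T) powr \<rho>) {T..t}"
  proof (rule fundamental_theorem_of_calculus_interior_strong[of "{u \<in> \<int>. T \<le> u \<and> u \<le> t}"])
    show "finite {u \<in> \<int>. T \<le> u \<and> u \<le> t}" by (rule finite_int_segment)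
    show "T \<le> t" by (rule t)
    show "continuous_on {T..t} (\<lambda>t. q t * (z + of_real t) powr \<rho>)"
      by (intro continuous_intros continuous_on_powr_complex continuous_on_subset[OF q])
         (auto simp: T_def complex_nonpos_Reals_iff complex_eq_iff)
    fix u assume u: "u \<in> {T<..<t} - {u \<in> \<int>. T \<le> u \<and> u \<le> t}"
    then have "u > 0" "u \<notin> \<int>" "u \<ge> T" using T by auto
    have "((\<lambda>t. z + of_real t) has_vector_derivative 1) (at u)"
      by (auto intro!: derivative_eq_intros)
    from field_vector_diff_chain_at[OF this has_field_derivative_powr[OF r(1)[OF \<open>u \<ge> T\<close>], of \<rho>]]
    have "((\<lambda>t. (z + of_real t) powr \<rho>) has_vector_derivative \<rho> * (z + of_real u) powr (\<rho> - 1)) (at u)"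
      by (simp add: o_def)
    from has_vector_derivative_mult[OF deriv[OF \<open>u > 0\<close> \<open>u \<notin> \<int>\<close>] this]
    show "((\<lambda>t. q t * (z + of_real t) powr \<rho>) has_vector_derivative
      p u * (z + of_real u) powr \<rho> + \<rho> * (q u * (z + of_real u) powr (\<rho> - 1))) (at u)"
      by (simp add: algebra_simps)
  qed
qed

lemma tail_integrable_continuous_powr:
  assumes "continuous_on {0..} q" shows "tail_integrable (\<lambda>t. q t * (z + of_real t) powr \<rho>)"
proof (rule tail_integrable_continuous[of "max 1 (1 - Re z)"])
  show "continuous_on {max 1 (1 - Re z)..} (\<lambda>t. q t * (z + of_real t) powr \<rho>)"
    by (intro continuous_intros continuous_on_powr_complex continuous_on_subset[OF assms])
       (auto simp: complex_nonpos_Reals_iff complex_eq_iff)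
qed

lemma tail_integrable_periodic_powr:
  assumes "mean_zero_periodic p" shows "tail_integrable (\<lambda>t. p t * (z + of_real t) powr \<rho>)"
proof -
  obtain q where q: "mean_zero_periodic q" "continuous_on {0..} q"
    "\<And>t. t > 0 \<Longrightarrow> t \<notin> \<int> \<Longrightarrow> (q has_vector_derivative p t) (at t)"
    using mean_zero_periodic_primitive[OF assms] by blast
  from tail_integrable_add[OF tail_integrable_if_primitive[OF tail_primitive_periodic_parts[OF q(2,3), where z=z and \<rho>=\<rho>]]
     tail_integrable_cmult[OF tail_integrable_continuous_powr[OF q(2)], of "-\<rho>" z "\<rho> - 1"]]
  show ?thesis by simp
qed

text \<open>
  An oscillating factor of mean zero makes any power, however fast it grows, negligible in every Cesaro
  sense. If \<open>Re \<rho> < a\<close> this is an ordinary limit. Each step of the induction on the excess of \<open>Re \<rho>\<close> over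
  \<open>a\<close> writes the function as a derivative, which gains one unit in \<open>a\<close>, minus a term whose exponent is
  smaller by one.
\<close>

lemma cesaro_asymp_periodic_powr:
  assumes "mean_zero_periodic p"
  shows "cesaro_asymp a (\<lambda>t. p t * (z + of_real t) powr \<rho>) 0"
proof -
  have "cesaro_asymp a (\<lambda>t. p t * (z + of_real t) powr \<rho>) 0"
    if "mean_zero_periodic p" "Re \<rho> - real m < real a" for m p \<rho> a
    using that
  proof (induction m arbitrary: p \<rho> a)
    case 0
    obtain B where B: "B \<ge> 0" "\<And>t. t \<ge> 0 \<Longrightarrow> norm (p t) \<le> B"
      using mean_zero_periodic_bounded[OF 0(1)] by blast
    obtain C where C: "C > 0" "\<And>t. t \<ge> 2 * norm z + 1 \<Longrightarrow> norm ((z + of_real t) powr \<rho>) \<le> C * t powr Re \<rho>"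
      using contour_powr_bound[of z \<rho>] by blast
    have "((\<lambda>t. p t * (z + of_real t) powr \<rho> / of_real t ^ a) \<longlongrightarrow> 0) at_top"
    proof (rule Lim_null_comparison)
      show "\<forall>\<^sub>F t in at_top. norm (p t * (z + of_real t) powr \<rho> / of_real t ^ a) \<le> B * C * t powr (Re \<rho> - real a)"
        using eventually_ge_at_top[of "2 * norm z + 1"]
      proof eventually_elim
        case (elim t)
        have t: "t > 0" using elim norm_ge_zero[of z] by linarith
        have "norm (p t * (z + of_real t) powr \<rho>) \<le> B * (C * t powr Re \<rho>)"
          unfolding norm_mult using B t C(2)[OF elim] by (intro mult_mono) auto
        then have "norm (p t * (z + of_real t) powr \<rho>) / t ^ a \<le> B * (C * t powr Re \<rho>) / t ^ a"
          using t by (intro divide_right_mono) auto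
        then show ?case using t by (simp add: norm_divide norm_power powr_diff powr_realpow)
      qed
      have "((\<lambda>t. t powr (Re \<rho> - real a)) \<longlongrightarrow> 0) at_top"
        using 0(2) by (intro tendsto_neg_powr filterlim_ident) auto
      then show "((\<lambda>t. B * C * t powr (Re \<rho> - real a)) \<longlongrightarrow> 0) at_top"
        by (rule tendsto_mult_right_zero)
    qed
    then show ?case by (rule cesaro_asymp.base[OF tail_integrable_periodic_powr[OF 0(1)]])
  next
    case (Suc m)
    obtain q where q: "mean_zero_periodic q" "continuous_on {0..} q"
      "\<And>t. t > 0 \<Longrightarrow> t \<notin> \<int> \<Longrightarrow> (q has_vector_derivative p t) (at t)"
      using mean_zero_periodic_primitive[OF Suc.prems(1)] by blast
    have "cesaro_asymp (Suc a) (\<lambda>t. q t * (z + of_real t) powr \<rho>) 0"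
      by (rule Suc.IH[OF q(1)]) (use Suc.prems(2) in simp)
    then have 1: "cesaro_asymp a (\<lambda>t. p t * (z + of_real t) powr \<rho> + \<rho> * (q t * (z + of_real t) powr (\<rho> - 1))) 0"
      by (intro cesaro_asymp.step[OF tail_primitive_periodic_parts[OF q(2,3)]]) simp_all
    have 2: "cesaro_asymp a (\<lambda>t. q t * (z + of_real t) powr (\<rho> - 1)) 0"
      by (rule Suc.IH[OF q(1)]) (use Suc.prems(2) in simp)
    from cesaro_asymp_diff[OF 1 cesaro_asymp_cmult[OF 2, of \<rho>]] show ?case by simp
  qed
  note induct = this
  show ?thesis by (rule induct[OF assms, where m = "nat \<lceil>\<bar>Re \<rho>\<bar>\<rceil> + 1"]) linarith
qed

lemma tail_primitive_unique:
  assumes "tail_primitive h H" "tail_primitive h G"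
  obtains c where "eventually (\<lambda>t. H t + c = G t) at_top"
proof -
  from tail_primitive_diff[OF assms(2,1)] have "tail_primitive (\<lambda>t. 0) (\<lambda>t. G t - H t)" by simp
  then obtain T where T: "\<And>a b. T \<le> a \<Longrightarrow> a \<le> b \<Longrightarrow> ((\<lambda>t. 0) has_integral ((G b - H b) - (G a - H a))) {a..b}"
    unfolding tail_primitive_def by blast
  have "H t + (G T - H T) = G t" if "t \<ge> T" for t
    using has_integral_unique[OF T[OF order_refl that] has_integral_0] by (simp add: algebra_simps)
  then have "eventually (\<lambda>t. H t + (G T - H T) = G t) at_top"
    unfolding eventually_at_top_linorder by blast
  then show ?thesis using that by blast
qed

lemma cesaro_asymp_other_primitive:
  assumes "tail_primitive h H" "tail_primitive h G" "cesaro_asymp 0 H L"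
  shows "\<exists>L. cesaro_asymp 0 G L"
proof -
  obtain c where c: "eventually (\<lambda>t. H t + c = G t) at_top" using tail_primitive_unique[OF assms(1,2)] by blast
  have "cesaro_asymp 0 (\<lambda>t. H t + c) (L + c)"
    by (rule cesaro_asymp_add_base[OF assms(3)])
       (auto intro!: tail_integrable_continuous[of 0])
  then show ?thesis using cesaro_asymp_eventually_eq[OF _ c] by blast
qed

text \<open>
  The comparison function \<open>e\<close> in the proof is the tail integral of the majorant \<open>K t^\<sigma>\<close>.
\<close>

lemma tail_primitive_convergent:
  fixes \<sigma> K :: real
  assumes P: "tail_primitive g G" and \<sigma>: "\<sigma> < -1" and K: "eventually (\<lambda>t. norm (g t) \<le> K * t powr \<sigma>) at_top"
  shows "\<exists>L. (G \<longlongrightarrow> L) at_top"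
proof -
  obtain T where T: "\<And>a b. T \<le> a \<Longrightarrow> a \<le> b \<Longrightarrow> (g has_integral (G b - G a)) {a..b}"
    using P unfolding tail_primitive_def by blast
  obtain S where S: "\<And>t. t \<ge> S \<Longrightarrow> norm (g t) \<le> K * t powr \<sigma>"
    using K unfolding eventually_at_top_linorder by blast
  define W where "W = max 1 (max T S)"
  define e where "e t = K / (- \<sigma> - 1) * t powr (\<sigma> + 1)" for t
  have bd: "norm (G b - G a) \<le> e a - e b" if ab: "W \<le> a" "a \<le> b" for a b
  proof -
    have "((\<lambda>t. - e t) has_real_derivative K * t powr \<sigma>) (at t within {a..b})" if "t \<in> {a..b}" for t
    proof -
      have "t > 0" using that ab by (auto simp: W_def)
      have "- (K / (- \<sigma> - 1) * ((\<sigma> + 1) * x)) = K * x" for x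
        using \<sigma> by (simp add: divide_simps) (simp add: algebra_simps)
      then show ?thesis
        unfolding e_def
        by (intro DERIV_cong[OF DERIV_minus[OF DERIV_cmult[OF
              has_field_derivative_at_within[OF has_real_derivative_powr[OF \<open>t > 0\<close>]]]]]) simp
    qed
    then have i: "((\<lambda>t. K * t powr \<sigma>) has_integral (- e b - - e a)) {a..b}"
      by (intro fundamental_theorem_of_calculus ab) (simp add: has_real_derivative_iff_has_vector_derivative)
    have g: "(g has_integral (G b - G a)) {a..b}" using ab by (intro T) (auto simp: W_def)
    have "norm (integral {a..b} g) \<le> integral {a..b} (\<lambda>t. K * t powr \<sigma>)"
      by (rule integral_norm_bound_integral) (use i g ab S in \<open>auto simp: W_def has_integral_integrable_integral\<close>)
    then show ?thesis unfolding integral_unique[OF i] integral_unique[OF g] by simp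
  qed
  have lim: "(e \<longlongrightarrow> 0) at_top"
    unfolding e_def using \<sigma> by (intro tendsto_mult_right_zero tendsto_neg_powr filterlim_ident) auto
  have anti: "e b \<le> e a" if "W \<le> a" "a \<le> b" for a b using bd[OF that] norm_ge_zero[of "G b - G a"] by linarith
  have e0: "e a \<ge> 0" if "W \<le> a" for a
    by (rule tendsto_upperbound[OF lim]) (auto intro: eventually_mono[OF eventually_ge_at_top[of a]] anti[OF that])
  have Ge: "norm (G b - G a) \<le> e a" if "W \<le> a" "a \<le> b" for a b
    using bd[OF that] e0[of b] that by linarith
  have "Cauchy (\<lambda>n. G (real n))"
  proof (rule metric_CauchyI)
    fix \<epsilon> :: real assume \<epsilon>: "\<epsilon> > 0"
    have "eventually (\<lambda>t. e t < \<epsilon> / 2) at_top" 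
      by (rule order_tendstoD(2)[OF lim]) (use \<epsilon> in simp)
    then obtain N where N: "\<And>t. t \<ge> N \<Longrightarrow> e t < \<epsilon> / 2" unfolding eventually_at_top_linorder by blast
    define M where "M = max N W"
    have M: "dist (G b) (G M) < \<epsilon> / 2" if "b \<ge> M" for b
      using Ge[of M b] N[of M] that by (simp add: M_def dist_norm)
    show "\<exists>M. \<forall>m\<ge>M. \<forall>n\<ge>M. dist (G (real m)) (G (real n)) < \<epsilon>"
    proof (intro exI allI impI)
      fix m n assume "nat \<lceil>M\<rceil> \<le> m" "nat \<lceil>M\<rceil> \<le> n"
      then have "M \<le> real m" "M \<le> real n" by linarith+
      then show "dist (G (real m)) (G (real n)) < \<epsilon>" using M dist_triangle_half_l by blast
    qed
  qed
  then obtain L where L: "(\<lambda>n. G (real n)) \<longlonglongrightarrow> L" using Cauchy_convergent convergent_def by blast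
  have "norm (G t - L) \<le> e t" if t: "t \<ge> W" for t
  proof (rule tendsto_upperbound)
    show "(\<lambda>n. norm (G t - G (real n))) \<longlonglongrightarrow> norm (G t - L)" by (intro tendsto_intros L)
    show "\<forall>\<^sub>F n in sequentially. norm (G t - G (real n)) \<le> e t"
      using eventually_ge_at_top[of "nat \<lceil>t\<rceil>"]
    proof eventually_elim
      case (elim n)
      then have "t \<le> real n" by linarith
      from Ge[OF t this] show ?case by (simp add: norm_minus_commute)
    qed
  qed simp
  then have "eventually (\<lambda>t. norm (G t - L) \<le> e t) at_top"
    unfolding eventually_at_top_linorder by blast
  then have "((\<lambda>t. G t - L) \<longlongrightarrow> 0) at_top" by (rule Lim_null_comparison[OF _ lim])
  then show ?thesis using Lim_null by blast
qed

text \<open>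
  Integration by parts lowers the exponent until the integral converges absolutely; by the
  preceding results the boundary terms have Cesaro limit \<open>0\<close>. The limit \<open>L\<close> itself stays
  unspecified, since only its existence is needed to define the zeta value.
\<close>

lemma cesaro_asymp_primitive_periodic_powr:
  assumes "mean_zero_periodic p"
  shows "\<exists>Q L. tail_primitive (\<lambda>t. p t * (z + of_real t) powr \<rho>) Q \<and> cesaro_asymp 0 Q L"
proof -
  have "\<exists>Q L. tail_primitive (\<lambda>t. p t * (z + of_real t) powr \<rho>) Q \<and> cesaro_asymp 0 Q L"
    if "mean_zero_periodic p" "Re \<rho> < real m - 1" for m p \<rho>
    using that
  proof (induction m arbitrary: p \<rho>)
    case 0
    obtain B where B: "B \<ge> 0" "\<And>t. t \<ge> 0 \<Longrightarrow> norm (p t) \<le> B"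
      using mean_zero_periodic_bounded[OF 0(1)] by blast
    obtain C where C: "C > 0" "\<And>t. t \<ge> 2 * norm z + 1 \<Longrightarrow> norm ((z + of_real t) powr \<rho>) \<le> C * t powr Re \<rho>"
      using contour_powr_bound[of z \<rho>] by blast
    obtain Q where Q: "tail_primitive (\<lambda>t. p t * (z + of_real t) powr \<rho>) Q"
      using tail_primitive_exists[OF tail_integrable_periodic_powr[OF 0(1)]] .
    have "\<exists>L. (Q \<longlongrightarrow> L) at_top"
    proof (rule tail_primitive_convergent[OF Q])
      show "Re \<rho> < -1" using 0(2) by simp
      show "\<forall>\<^sub>F t in at_top. norm (p t * (z + of_real t) powr \<rho>) \<le> (B * C) * t powr Re \<rho>"
        using eventually_ge_at_top[of "2 * norm z + 1"]
      proof eventually_elim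
        case (elim t)
        have t: "t > 0" using elim norm_ge_zero[of z] by linarith
        show ?case unfolding norm_mult mult.assoc using B t C(2)[OF elim] by (intro mult_mono) auto
      qed
    qed
    then obtain L where L: "(Q \<longlongrightarrow> L) at_top" by blast
    have "cesaro_asymp 0 Q L" by (rule cesaro_asymp.base[OF tail_integrable_primitive[OF Q]]) (use L in simp)
    then show ?case using Q by blast
  next
    case (Suc m)
    obtain q where q: "mean_zero_periodic q" "continuous_on {0..} q"
      "\<And>t. t > 0 \<Longrightarrow> t \<notin> \<int> \<Longrightarrow> (q has_vector_derivative p t) (at t)"
      using mean_zero_periodic_primitive[OF Suc.prems(1)] by blast
    have "\<exists>Q L. tail_primitive (\<lambda>t. q t * (z + of_real t) powr (\<rho> - 1)) Q \<and> cesaro_asymp 0 Q L"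
      by (rule Suc.IH[OF q(1)]) (use Suc.prems(2) in simp)
    then obtain Q L where Q: "tail_primitive (\<lambda>t. q t * (z + of_real t) powr (\<rho> - 1)) Q" "cesaro_asymp 0 Q L"
      by blast
    have "tail_primitive (\<lambda>t. p t * (z + of_real t) powr \<rho>) (\<lambda>t. q t * (z + of_real t) powr \<rho> - \<rho> * Q t)"
      using tail_primitive_diff[OF tail_primitive_periodic_parts[OF q(2,3), of z \<rho>] tail_primitive_cmult[OF Q(1), of \<rho>]]
      by simp
    moreover have "cesaro_asymp 0 (\<lambda>t. q t * (z + of_real t) powr \<rho> - \<rho> * Q t) (0 - \<rho> * L)"
      by (intro cesaro_asymp_diff cesaro_asymp_periodic_powr q(1) cesaro_asymp_cmult Q(2))
    ultimately show ?case by blast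
  qed
  note induct = this
  show ?thesis by (rule induct[OF assms, where m = "nat \<lceil>\<bar>Re \<rho>\<bar>\<rceil> + 2"]) linarith
qed

section \<open>Partial sums of the Hurwitz series\<close>

lemma borel_measurable_partial_sum_fun: "partial_sum_fun f z \<in> borel_measurable borel"
proof -
  have "(\<lambda>t::real. nat \<lfloor>t\<rfloor>) \<in> measurable borel (count_space UNIV)"
    by measurable
  then show ?thesis
    unfolding partial_sum_fun_def[abs_def]
    by (rule measurable_compose[where g = "\<lambda>k. \<Sum>m=1..k. f (z + of_nat m)"]) simp
qed

lemma norm_partial_sum_fun_le:
  assumes "t \<le> T" shows "norm (partial_sum_fun f z t) \<le> (\<Sum>m=1..nat \<lfloor>T\<rfloor>. norm (f (z + of_nat m)))"
proof -
  have "norm (partial_sum_fun f z t) \<le> (\<Sum>m=1..nat \<lfloor>t\<rfloor>. norm (f (z + of_nat m)))"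
    unfolding partial_sum_fun_def by (rule norm_sum)
  also have "\<dots> \<le> (\<Sum>m=1..nat \<lfloor>T\<rfloor>. norm (f (z + of_nat m)))"
    by (rule sum_mono2) (use assms floor_mono nat_mono in force)+
  finally show ?thesis .
qed

lemma locally_tame_measurable:
  assumes h: "h \<in> borel_measurable borel" and b: "\<And>T. T > 0 \<Longrightarrow> \<exists>M. \<forall>t\<in>{0..T}. norm (h t) \<le> M"
  shows "locally_tame h"
  unfolding locally_tame_def
proof (intro allI impI conjI b)
  fix T :: real assume T: "T > 0"
  obtain M where M: "\<And>t. t \<in> {0..T} \<Longrightarrow> norm (h t) \<le> M" using b[OF T] by blast
  show "h integrable_on {0..T}"
  proof (rule measurable_bounded_by_integrable_imp_integrable)
    have "h \<in> borel_measurable lebesgue" using h by (intro measurable_completion) simp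
    then show "h \<in> borel_measurable (lebesgue_on {0..T})" by (rule measurable_restrict_space1)
    show "(\<lambda>t. M) integrable_on {0..T}" by (simp add: integrable_const_ivl)
  qed (use M in auto)
qed

lemma locally_tame_partial_sum_fun: "locally_tame (partial_sum_fun f z)"
  by (rule locally_tame_measurable[OF borel_measurable_partial_sum_fun])
     (use norm_partial_sum_fun_le in \<open>meson atLeastAtMost_iff\<close>)

text \<open>
  If \<open>z\<close> is real then the contour may run along the branch cut of the logarithm, where continuity on
  open sets is of no use; there the power is given by explicit formulas on the two half-lines.
\<close>

lemma borel_measurable_contour_powr: "(\<lambda>t. ((z :: complex) + of_real t) powr \<rho>) \<in> borel_measurable borel"
proof (cases "Im z = 0")
  case False
  have "continuous_on UNIV (\<lambda>t::real. (z + of_real t) powr \<rho>)"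
    by (intro continuous_on_powr_complex continuous_intros) (use False in \<open>auto simp: complex_eq_iff\<close>)
  then show ?thesis by (rule borel_measurable_continuous_onI)
next
  case True
  have "(\<lambda>x. of_real x powr \<rho>) \<in> borel_measurable (borel :: real measure)"
  proof -
    have "(\<lambda>x. of_real x powr \<rho>) = (\<lambda>x. if x = 0 then 0 else if x > 0 then exp (\<rho> * of_real (ln x))
        else exp (\<rho> * (of_real (ln (- x)) + \<i> * of_real pi)))"
    proof
      fix x :: real
      consider "x = 0" | "x > 0" | "x < 0" by linarith
      then show "of_real x powr \<rho> = (if x = 0 then 0 else if x > 0 then exp (\<rho> * of_real (ln x))
        else exp (\<rho> * (of_real (ln (- x)) + \<i> * of_real pi)))"
      proof cases
        case 3
        have "Ln (- of_real (- x)) = Ln (of_real (- x)) + \<i> * of_real pi"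
          using 3 by (subst Ln_minus) auto
        also have "Ln (of_real (- x)) = of_real (ln (- x))"
          by (rule Ln_of_real) (use 3 in simp)
        finally have "Ln (of_real x) = of_real (ln (- x)) + \<i> * of_real pi" by simp
        then show ?thesis using 3 by (simp add: powr_def)
      qed (auto simp: powr_def Ln_of_real)
    qed
    also have "\<dots> \<in> borel_measurable borel" by measurable
    finally show ?thesis .
  qed
  then have "(\<lambda>t. of_real (Re z + t) powr \<rho>) \<in> borel_measurable (borel :: real measure)"
    by (rule measurable_compose[rotated]) measurable
  moreover have "z + of_real t = of_real (Re z + t)" for t using True by (simp add: complex_eq_iff)
  ultimately show ?thesis by simp
qed

lemma locally_tame_contour_powr:
  assumes "Re \<rho> \<ge> 0" shows "locally_tame (\<lambda>t. (z + of_real t) powr \<rho>)"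
proof (rule locally_tame_measurable[OF borel_measurable_contour_powr])
  fix T :: real assume "T > 0"
  have "norm ((z + of_real t) powr \<rho>) \<le> (norm z + T) powr Re \<rho> * exp (pi * \<bar>Im \<rho>\<bar>)" if t: "t \<in> {0..T}" for t
  proof (rule order_trans[OF norm_powr_le mult_right_mono])
    have "norm (z + of_real t) \<le> norm z + T" using norm_triangle_ineq[of z "of_real t"] t by simp
    then show "norm (z + of_real t) powr Re \<rho> \<le> (norm z + T) powr Re \<rho>"
      using assms by (intro powr_mono2) auto
  qed simp
  then show "\<exists>M. \<forall>t\<in>{0..T}. norm ((z + of_real t) powr \<rho>) \<le> M" by blast
qed

text \<open>
  The first periodised Bernoulli polynomial.
\<close>

definition sawtooth :: "real \<Rightarrow> complex" where
  "sawtooth t = of_real (frac t - 1 / 2)"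

lemma mean_zero_periodic_sawtooth: "mean_zero_periodic sawtooth"
  unfolding mean_zero_periodic_def
proof (intro conjI allI impI)
  show "sawtooth (t + 1) = sawtooth t" for t by (simp add: sawtooth_def frac_1_eq)
  show "isCont sawtooth t" if "t \<notin> \<int>" for t
    unfolding sawtooth_def[abs_def] by (intro continuous_intros continuous_frac that)
  show "locally_tame sawtooth"
  proof (rule locally_tame_measurable)
    show "sawtooth \<in> borel_measurable borel" unfolding sawtooth_def[abs_def] frac_def by measurable
    have "norm (sawtooth t) \<le> 1" for t
      using frac_ge_0[of t] frac_lt_1[of t] unfolding sawtooth_def norm_of_real by linarith
    then show "\<exists>M. \<forall>t\<in>{0..T}. norm (sawtooth t) \<le> M" for T by blast
  qed
  have "((\<lambda>t. of_real (t - 1/2) :: complex) has_integral (of_real ((1\<^sup>2 - 1) / 2) - of_real ((0\<^sup>2 - 0) / 2))) {0..1}"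
  proof (rule fundamental_theorem_of_calculus)
    fix t :: real
    have "((\<lambda>t. (t\<^sup>2 - t) / 2) has_real_derivative (t - 1/2)) (at t within {0..1})"
      by (auto intro!: derivative_eq_intros)
    then show "((\<lambda>t. of_real ((t\<^sup>2 - t) / 2) :: complex) has_vector_derivative of_real (t - 1/2)) (at t within {0..1})"
      by (rule has_vector_derivative_of_real)
  qed simp
  then have "(sawtooth has_integral (of_real ((1\<^sup>2 - 1) / 2) - of_real ((0\<^sup>2 - 0) / 2))) {0..1}"
    by (rule has_integral_spike_finite[of "{1}", rotated 2]) (auto simp: sawtooth_def frac_eq[THEN iffD2])
  then have "(sawtooth has_integral 0) {0..1}" by simp
  then show "integral {0..1} sawtooth = 0" by (rule integral_unique)
qed

text \<open>
  Euler-Maclaurin summation of first order. The jumps of the partial sums at the integers are cancelled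
  by those of the sawtooth term, and between the integers the derivative of the power
  \<open>(z + t)^(1 - s) / (1 - s)\<close> cancels the one coming from the slope of the sawtooth.
\<close>

lemma tail_primitive_hurwitz:
  assumes s: "s \<noteq> 1"
  shows "tail_primitive (\<lambda>t. - s * (sawtooth t * (z + of_real t) powr (- s - 1)))
    (\<lambda>t. partial_sum_fun (\<lambda>w. w powr (- s)) z t + sawtooth t * (z + of_real t) powr (- s)
         - (z + of_real t) powr (1 - s) / (1 - s))"
    (is "tail_primitive ?w ?V")
proof -
  define K where "K = nat \<lceil>max 1 (1 - Re z)\<rceil>"
  have K: "real K \<ge> 1 - Re z" "real K \<ge> 1" unfolding K_def by linarith+
  let ?F = "partial_sum_fun (\<lambda>w. w powr (- s)) z"
  have piece: "(?w has_integral ?V t - ?V (real k)) {real k..t}" if k: "k \<ge> K" and t: "real k \<le> t" "t \<le> real k + 1" for k t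
  proof -
    \<comment> \<open>a single smooth formula on the closed interval \<open>{k..k+1}\<close>: at the right end point the jumps of the partial sum and of the sawtooth cancel\<close>
    define V where "V u = ?F (real k) + (of_real (u - real k - 1/2) * (z + of_real u) powr (- s)
         - (z + of_real u) powr (1 - s) / (1 - s))" for u
    have r: "z + of_real u \<notin> \<real>\<^sub>\<le>\<^sub>0" "z + of_real u \<noteq> 0" if "u \<ge> real k" for u
      using that K k by (auto simp: complex_nonpos_Reals_iff complex_eq_iff)
    have deriv: "(V has_vector_derivative - s * (of_real (u - real k - 1/2) * (z + of_real u) powr (- s - 1))) (at u)"
      if u: "u \<ge> real k" for u
    proof -
      have g: "((\<lambda>t. z + of_real t) has_vector_derivative 1) (at u)"
        by (auto intro!: derivative_eq_intros)
      have pw: "((\<lambda>t. (z + of_real t) powr \<rho>) has_vector_derivative \<rho> * (z + of_real u) powr (\<rho> - 1)) (at u)" for \<rho>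
        using field_vector_diff_chain_at[OF g has_field_derivative_powr[OF r(1)[OF u], of \<rho>]] by (simp add: o_def)
      have l: "((\<lambda>u. of_real (u - real k - 1/2)) has_vector_derivative (1::complex)) (at u)"
        by (auto intro!: derivative_eq_intros)
      have "(V has_vector_derivative (0 + ((of_real (u - real k - 1/2) * (- s * (z + of_real u) powr (- s - 1))
          + 1 * (z + of_real u) powr (- s)) - (1 - s) * (z + of_real u) powr (1 - s - 1) / (1 - s)))) (at u)"
        unfolding V_def
        by (intro has_vector_derivative_add has_vector_derivative_const has_vector_derivative_diff
              has_vector_derivative_mult l pw has_vector_derivative_divide)
      then show ?thesis using s by (simp add: mult_ac)
    qed
    have "((\<lambda>u. - s * (of_real (u - real k - 1/2) * (z + of_real u) powr (- s - 1))) has_integral V t - V (real k)) {real k..t}"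
      by (intro fundamental_theorem_of_calculus t(1) has_vector_derivative_at_within[OF deriv]) auto
    then have "(?w has_integral V t - V (real k)) {real k..t}"
    proof (rule has_integral_spike_finite[of "{real k + 1}", rotated 2])
      fix u assume "u \<in> {real k..t} - {real k + 1}"
      then have "\<lfloor>u\<rfloor> = int k" using t by (auto simp: floor_eq_iff)
      then show "?w u = - s * (of_real (u - real k - 1/2) * (z + of_real u) powr (- s - 1))"
        by (simp add: sawtooth_def frac_def)
    qed simp
    moreover have eqV: "?V u = V u" if "real k \<le> u" "u \<le> real k + 1" for u
    proof (cases "u = real k + 1")
      case False
      then have "\<lfloor>u\<rfloor> = int k" using that by (auto simp: floor_eq_iff)
      then show ?thesis by (simp add: V_def sawtooth_def frac_def partial_sum_fun_def)
    next
      case True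
      have "nat \<lfloor>real k + 1\<rfloor> = Suc k" "nat \<lfloor>real k\<rfloor> = k" by linarith+
      then have "?F (real k + 1) = ?F (real k) + (z + of_real (real k + 1)) powr (- s)"
        unfolding partial_sum_fun_def by (simp add: add_ac)
      moreover have "sawtooth (real k + 1) = - 1 / 2" by (simp add: sawtooth_def frac_1_eq frac_def)
      ultimately show ?thesis unfolding True V_def by (simp add: algebra_simps)
    qed
    have "?V t = V t" by (rule eqV[OF t])
    moreover have "?V (real k) = V (real k)" by (rule eqV) auto
    ultimately show ?thesis by (simp only:)
  qed
  have tele: "(x - y) + (w - x) = w - y" for w x y :: complex by simp
  have whole: "(?w has_integral ?V (real k) - ?V (real K)) {real K..real k}" if "k \<ge> K" for k
    using that
  proof (induction k rule: dec_induct)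
    case base
    show ?case using has_integral_refl(2)[of ?w "real K"] by simp
  next
    case (step k)
    have "(?w has_integral (?V (real k) - ?V (real K)) + (?V (real (Suc k)) - ?V (real k))) {real K..real (Suc k)}"
      by (rule has_integral_combine[OF _ _ step.IH piece]) (use step.hyps in auto)
    then show ?case unfolding tele .
  qed
  show ?thesis
  proof (rule tail_primitive_from_base[of "real K"])
    fix t assume t: "real K \<le> t"
    define k where "k = nat \<lfloor>t\<rfloor>"
    have k: "K \<le> k" "real k \<le> t" "t \<le> real k + 1" using t unfolding k_def by linarith+
    have "(?w has_integral (?V (real k) - ?V (real K)) + (?V t - ?V (real k))) {real K..t}"
      by (rule has_integral_combine[OF _ _ whole piece]) (use k in auto)
    then show "(?w has_integral ?V t - ?V (real K)) {real K..t}" unfolding tele .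
  qed
qed

lemma hurwitz_cesaro_asymp:
  assumes s: "s \<noteq> 1"
  shows "\<exists>L. cesaro_asymp 0 (\<lambda>t. partial_sum_fun (\<lambda>w. w powr (- s)) z t - (z + of_real t) powr (1 - s) / (1 - s)) L"
proof -
  obtain Q L where Q: "tail_primitive (\<lambda>t. sawtooth t * (z + of_real t) powr (- s - 1)) Q" "cesaro_asymp 0 Q L"
    using cesaro_asymp_primitive_periodic_powr[OF mean_zero_periodic_sawtooth] by blast
  obtain M where M: "cesaro_asymp 0 (\<lambda>t. partial_sum_fun (\<lambda>w. w powr (- s)) z t + sawtooth t * (z + of_real t) powr (- s)
         - (z + of_real t) powr (1 - s) / (1 - s)) M"
    using cesaro_asymp_other_primitive[OF tail_primitive_cmult[OF Q(1)] tail_primitive_hurwitz[OF s] cesaro_asymp_cmult[OF Q(2)]]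
    by blast
  from cesaro_asymp_diff[OF M cesaro_asymp_periodic_powr[OF mean_zero_periodic_sawtooth, of 0 z "- s"]]
  show ?thesis by (auto simp: algebra_simps)
qed

section \<open>The value of the Hurwitz zeta function\<close>

lemma tail_integrable_locally_tame: "locally_tame h \<Longrightarrow> tail_integrable h"
  using tail_primitive_integral_from_0 locally_tame_integrable tail_integrable_if_primitive by blast

text \<open>
  The difference of the two decompositions of the same partial sum is a sum of powers and logarithms
  with non-zero exponents that has a Cesaro limit, so that limit is \<open>0\<close>.
\<close>

lemma remainder_cesaro_sum_unique:
  assumes s: "s \<noteq> 1"
    and L: "cesaro_asymp 0 (\<lambda>t. partial_sum_fun f z t - (z + of_real t) powr (1 - s) / (1 - s)) L"
    and M: "has_remainder_cesaro_sum f z M"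
  shows "M = L"
proof -
  obtain q :: nat and a \<rho> l R where \<rho>: "\<forall>i<q. \<rho> i \<noteq> 0"
    and F: "\<forall>t\<ge>0. z + of_real t \<noteq> 0 \<longrightarrow> partial_sum_fun f z t =
             (\<Sum>i<q. a i * (z + of_real t) powr \<rho> i * (Ln (z + of_real t)) ^ l i) + R t"
    and R: "has_cesaro_limit R M"
    using M unfolding has_remainder_cesaro_sum_def by (elim exE conjE) (rule that, assumption+)
  \<comment> \<open>the pole term is adjoined as the term with index \<open>q\<close>\<close>
  define p where "p i = (if i < q then monom (- a i) (l i) else [:1 / (1 - s):])" for i
  define \<rho>' where "\<rho>' i = (if i < q then \<rho> i else 1 - s)" for i
  have sum: "power_log_sum {..q} \<rho>' p w = w powr (1 - s) / (1 - s) - (\<Sum>i<q. a i * w powr \<rho> i * Ln w ^ l i)" for w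
  proof -
    have "power_log_sum {..q} \<rho>' p w = (\<Sum>i<q. w powr \<rho>' i * poly (p i) (Ln w)) + w powr (1 - s) / (1 - s)"
      by (simp add: power_log_sum_def lessThan_Suc_atMost[symmetric] p_def \<rho>'_def)
    also have "(\<Sum>i<q. w powr \<rho>' i * poly (p i) (Ln w)) = (\<Sum>i<q. - (a i * w powr \<rho> i * Ln w ^ l i))"
      by (intro sum.cong) (auto simp: p_def \<rho>'_def poly_monom)
    finally show ?thesis by (simp add: sum_negf)
  qed
  have ev: "eventually (\<lambda>t. R t = partial_sum_fun f z t - (\<Sum>i<q. a i * (z + of_real t) powr \<rho> i * Ln (z + of_real t) ^ l i)) at_top"
    using eventually_ge_at_top[of "max 0 (1 - Re z)"]
  proof eventually_elim
    case (elim t)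
    then have "z + of_real t \<noteq> 0" by (auto simp: complex_eq_iff)
    then show ?case using F elim by simp
  qed
  have "continuous_on {1 - Re z..} (\<lambda>t. \<Sum>i<q. a i * (z + of_real t) powr \<rho> i * Ln (z + of_real t) ^ l i)"
    by (intro continuous_intros continuous_on_powr_complex) (auto simp: complex_nonpos_Reals_iff complex_eq_iff)
  then have "tail_integrable (\<lambda>t. partial_sum_fun f z t + (-1) * (\<Sum>i<q. a i * (z + of_real t) powr \<rho> i * Ln (z + of_real t) ^ l i))"
    by (intro tail_integrable_add tail_integrable_cmult tail_integrable_locally_tame locally_tame_partial_sum_fun
         tail_integrable_continuous)
  then have "tail_integrable R"
    by (rule tail_integrable_eventually_eq) (use ev in eventually_elim, simp)
  then have "cesaro_asymp 0 R M" by (rule has_cesaro_limit_imp_cesaro_asymp[OF R])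
  from cesaro_asymp_diff[OF cesaro_asymp_eventually_eq[OF this ev] L]
  have "cesaro_asymp 0 (\<lambda>t. power_log_sum {..q} \<rho>' p (z + of_real t)) (M - L)"
    by (simp add: sum algebra_simps)
  then have "M - L = 0"
    by (rule cesaro_asymp_power_log_sum_eq_0[rotated 2]) (use \<rho> s in \<open>auto simp: \<rho>'_def\<close>)
  then show ?thesis by simp
qed

text \<open>
  For \<open>Re s \<le> 1\<close> the pole term \<open>(z + t)^(1 - s) / (1 - s)\<close> has to be removed, and it is bounded near a
  zero of \<open>z + t\<close>. For \<open>Re s > 1\<close> it tends to \<open>0\<close> but may fail to be integrable near such a zero, so
  there the partial sum itself serves as remainder.
\<close>

lemma remainder_cesaro_sum_exists:
  assumes s: "s \<noteq> 1"
    and L: "cesaro_asymp 0 (\<lambda>t. partial_sum_fun f z t - (z + of_real t) powr (1 - s) / (1 - s)) L"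
  shows "has_remainder_cesaro_sum f z L"
proof (cases "Re s \<le> 1")
  case True
  have "locally_tame (\<lambda>t. 1 * partial_sum_fun f z t + (- 1 / (1 - s)) * (z + of_real t) powr (1 - s))"
    using True by (intro locally_tame_lincomb locally_tame_partial_sum_fun locally_tame_contour_powr) simp
  then have "has_cesaro_limit (\<lambda>t. partial_sum_fun f z t - (z + of_real t) powr (1 - s) / (1 - s)) L"
    by (intro cesaro_asymp_imp_has_cesaro_limit[OF L]) simp
  then show ?thesis
    unfolding has_remainder_cesaro_sum_def
    by (intro exI[of _ 1] exI[of _ "\<lambda>_. 1 / (1 - s)"] exI[of _ "\<lambda>_. 1 - s"] exI[of _ "\<lambda>_. 0"]
          exI[of _ "\<lambda>t. partial_sum_fun f z t - (z + of_real t) powr (1 - s) / (1 - s)"]) (use s in auto)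
next
  case False
  obtain C where C: "C > 0" "\<And>t. t \<ge> 2 * norm z + 1 \<Longrightarrow> norm ((z + of_real t) powr (1 - s)) \<le> C * t powr Re (1 - s)"
    using contour_powr_bound[of z "1 - s"] by blast
  have "((\<lambda>t. (z + of_real t) powr (1 - s)) \<longlongrightarrow> 0) at_top"
  proof (rule Lim_null_comparison)
    show "\<forall>\<^sub>F t in at_top. norm ((z + of_real t) powr (1 - s)) \<le> C * t powr Re (1 - s)"
      using eventually_ge_at_top[of "2 * norm z + 1"] by eventually_elim (rule C(2))
    show "((\<lambda>t. C * t powr Re (1 - s)) \<longlongrightarrow> 0) at_top"
      by (intro tendsto_mult_right_zero tendsto_neg_powr filterlim_ident) (use False in simp)
  qed
  from tendsto_mult_right_zero[OF this, of "1 / (1 - s)"]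
  have "((\<lambda>t. 1 / (1 - s) * (z + of_real t) powr (1 - s) / of_real t ^ 0) \<longlongrightarrow> 0) at_top"
    by simp
  moreover have "tail_integrable (\<lambda>t. 1 / (1 - s) * (z + of_real t) powr (1 - s))"
    by (rule tail_integrable_continuous_powr) (rule continuous_intros)
  ultimately have "cesaro_asymp 0 (partial_sum_fun f z) L"
    using cesaro_asymp_add_base[OF L] by fastforce
  then have "has_cesaro_limit (partial_sum_fun f z) L"
    by (intro cesaro_asymp_imp_has_cesaro_limit locally_tame_partial_sum_fun)
  then show ?thesis
    unfolding has_remainder_cesaro_sum_def
    by (intro exI[of _ 0] exI[of _ "\<lambda>_. 0"] exI[of _ "\<lambda>_. 0"] exI[of _ "\<lambda>_. 0"]
          exI[of _ "partial_sum_fun f z"]) auto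
qed

text \<open>
  This replaces the definition of the zeta function from here on: a single pole term, the same for
  all \<open>s\<close>, and a notion of limit that is invariant under affine substitutions.
\<close>

lemma zeta_H_eqI:
  assumes "s \<noteq> 1"
    and "cesaro_asymp 0 (\<lambda>t. partial_sum_fun (\<lambda>w. w powr (- s)) z t - (z + of_real t) powr (1 - s) / (1 - s)) L"
  shows "zeta_H z s = L"
  unfolding zeta_H_def
  using remainder_cesaro_sum_exists[OF assms] remainder_cesaro_sum_unique[OF assms] by (intro the_equality)

lemma zeta_H_cesaro_asymp:
  assumes "s \<noteq> 1"
  shows "cesaro_asymp 0 (\<lambda>t. partial_sum_fun (\<lambda>w. w powr (- s)) z t - (z + of_real t) powr (1 - s) / (1 - s)) (zeta_H z s)"
  using hurwitz_cesaro_asymp[OF assms, of z] zeta_H_eqI[OF assms] by blast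

section \<open>Splitting the sum into residue classes\<close>

lemma powr_divide_of_nat:
  fixes w :: complex
  assumes "n > 0" shows "(w / of_nat n) powr \<rho> = w powr \<rho> * of_nat n powr (- \<rho>)"
proof (cases "w = 0")
  case False
  have "Ln (w / of_nat n) = Ln w - of_real (ln (real n))"
    using Ln_divide_of_real[of "real n" w] assms False by simp
  then have "\<rho> * Ln (w / of_nat n) = \<rho> * (Ln w - of_real (ln (real n)))" by (simp only:)
  also have "\<dots> = \<rho> * Ln w + - \<rho> * of_real (ln (real n))" by (simp add: algebra_simps)
  finally show ?thesis
    using assms False by (simp add: powr_def Ln_of_nat exp_add[symmetric])
qed simp

text \<open>
  The shift \<open>n - j\<close> of the argument is chosen so that the two sides agree exactly and not only
  asymptotically: the \<open>j\<close>-th partial sum then contains precisely the terms with index \<open>\<equiv> j\<close> modulo \<open>n\<close>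
  that are at most \<open>t\<close>.
\<close>

lemma partial_sum_fun_multisection:
  fixes f :: "complex \<Rightarrow> complex"
  assumes n: "n \<ge> (1::nat)" and t: "t \<ge> 0"
  shows "(\<Sum>j=1..n. partial_sum_fun (\<lambda>w. f (of_nat n * w)) (z / of_nat n - (of_nat n - of_nat j) / of_nat n)
            ((t + (real n - real j)) / real n)) = partial_sum_fun f z t"
proof -
  define N where "N = nat \<lfloor>t\<rfloor>"
  have fl: "nat \<lfloor>(t + (real n - real j)) / real n\<rfloor> = (N + (n - j)) div n" if "j \<in> {1..n}" for j
  proof -
    have "(t + (real n - real j)) / real n = (t + real (n - j)) / real n" using that by (simp add: of_nat_diff)
    also have "\<lfloor>\<dots>\<rfloor> = \<lfloor>t + real (n - j)\<rfloor> div int n"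
      using floor_divide_real_eq_div[of "int n" "t + real (n - j)"] by simp
    also have "\<lfloor>t + real (n - j)\<rfloor> = int (N + (n - j))" using t by (simp add: N_def)
    finally show ?thesis by (metis nat_int zdiv_int)
  qed
  have arg: "of_nat n * (z / of_nat n - (of_nat n - of_nat j) / of_nat n + of_nat m) = z + of_nat (n * (m - 1) + j)"
    if "m \<ge> 1" for m j
  proof -
    have "of_nat m = (of_nat (m - 1) + 1 :: complex)" using that by (simp add: of_nat_diff)
    moreover have "of_nat n \<noteq> (0 :: complex)" using n by simp
    ultimately show ?thesis by (simp add: field_simps)
  qed
  have "(\<Sum>j=1..n. partial_sum_fun (\<lambda>w. f (of_nat n * w)) (z / of_nat n - (of_nat n - of_nat j) / of_nat n)
            ((t + (real n - real j)) / real n)) = (\<Sum>j=1..n. \<Sum>m=1..(N + (n - j)) div n. f (z + of_nat (n * (m - 1) + j)))"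
    unfolding partial_sum_fun_def by (intro sum.cong) (auto simp: fl arg simp del: of_nat_add of_nat_mult)
  also have "\<dots> = (\<Sum>(j, m)\<in>Sigma {1..n} (\<lambda>j. {1..(N + (n - j)) div n}). f (z + of_nat (n * (m - 1) + j)))"
    by (rule sum.Sigma) auto
  also have "\<dots> = (\<Sum>k=1..N. f (z + of_nat k))"
  proof (rule sum.reindex_bij_witness[where j = "\<lambda>(j, m). n * (m - 1) + j" and
        i = "\<lambda>k. ((k - 1) mod n + 1, (k - 1) div n + 1)"])
    fix jm assume "jm \<in> Sigma {1..n} (\<lambda>j. {1..(N + (n - j)) div n})"
    then obtain j m where jm: "jm = (j, m)" "1 \<le> j" "j \<le> n" "1 \<le> m" "m \<le> (N + (n - j)) div n" by auto
    obtain i where i: "j = Suc i" "i < n" using jm by (cases j) auto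
    obtain k where k: "m = Suc k" using jm by (cases m) auto
    have "m * n \<le> N + (n - j)" using jm n by (simp add: less_eq_div_iff_mult_less_eq)
    then have "n * k + j \<le> N" using jm k by (simp add: algebra_simps)
    then show "(case jm of (j, m) \<Rightarrow> n * (m - 1) + j) \<in> {1..N}" using jm k by simp
    show "(((case jm of (j, m) \<Rightarrow> n * (m - 1) + j) - 1) mod n + 1,
        ((case jm of (j, m) \<Rightarrow> n * (m - 1) + j) - 1) div n + 1) = jm"
      using jm i k by simp
  next
    fix k assume k: "k \<in> {1..N}"
    have d: "n * ((k - 1) div n) + (k - 1) mod n = k - 1" by simp
    have m: "(k - 1) mod n < n" using n by simp
    show "(case ((k - 1) mod n + 1, (k - 1) div n + 1) of (j, m) \<Rightarrow> n * (m - 1) + j) = k"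
      using d k by simp
    have "x + n \<le> N + (n - (y + 1))" if "x + y = k - 1" "y < n" for x y
      using that k by auto
    from this[OF d m] have "((k - 1) div n + 1) * n \<le> N + (n - ((k - 1) mod n + 1))"
      by (simp add: algebra_simps)
    then have "(k - 1) div n + 1 \<le> (N + (n - ((k - 1) mod n + 1))) div n"
      using n by (simp add: less_eq_div_iff_mult_less_eq)
    then show "((k - 1) mod n + 1, (k - 1) div n + 1) \<in> Sigma {1..n} (\<lambda>j. {1..(N + (n - j)) div n})"
      using m by simp
  qed auto
  finally show ?thesis by (simp add: partial_sum_fun_def N_def)
qed

theorem mainTheorem5:
  fixes n :: nat and s z :: complex
  assumes "n \<ge> 1" and "s \<noteq> 1" and "z \<notin> {of_int k | k. k < 0}"
  shows "zeta_H z s =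
    of_nat n powr (- s) * (\<Sum>j=1..n. zeta_H (z / of_nat n - (of_nat n - of_nat j) / of_nat n) s)"
proof (rule zeta_H_eqI[OF assms(2)])
  let ?w = "\<lambda>j. z / of_nat n - (of_nat n - of_nat j) / of_nat n"
  let ?F = "partial_sum_fun (\<lambda>w. w powr (- s))"
  let ?u = "\<lambda>j t. (t + (real n - real j)) / real n"
  have n0: "n > 0" "of_nat n \<noteq> (0::complex)" "real n > 0" using assms(1) by auto
  have "cesaro_asymp 0 (\<lambda>t. ?F (?w j) (?u j t) - (?w j + of_real (?u j t)) powr (1 - s) / (1 - s)) (zeta_H (?w j) s)" for j
    using cesaro_asymp_affine[OF zeta_H_cesaro_asymp[OF assms(2), of "?w j"], of "1 / real n" "(real n - real j) / real n"] n0
    by (simp add: add_divide_distrib)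
  then have "cesaro_asymp 0 (\<lambda>t. of_nat n powr (- s) * (\<Sum>j=1..n. ?F (?w j) (?u j t) - (?w j + of_real (?u j t)) powr (1 - s) / (1 - s)))
     (of_nat n powr (- s) * (\<Sum>j=1..n. zeta_H (?w j) s))"
    by (intro cesaro_asymp_cmult cesaro_asymp_sum) auto
  then show "cesaro_asymp 0 (\<lambda>t. ?F z t - (z + of_real t) powr (1 - s) / (1 - s))
     (of_nat n powr (- s) * (\<Sum>j=1..n. zeta_H (?w j) s))"
  proof (rule cesaro_asymp_eventually_eq)
    show "\<forall>\<^sub>F t in at_top. of_nat n powr (- s) * (\<Sum>j=1..n. ?F (?w j) (?u j t) - (?w j + of_real (?u j t)) powr (1 - s) / (1 - s))
       = ?F z t - (z + of_real t) powr (1 - s) / (1 - s)"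
      using eventually_ge_at_top[of 0]
    proof eventually_elim
      case (elim t)
      have scale: "of_nat n powr (- s) * w powr (- s) = (of_nat n * w) powr (- s)" for w
        using powr_divide_of_nat[OF n0(1), of "of_nat n * w" "- s"] n0 by (simp add: powr_minus field_simps)
      have "of_nat n powr (- s) * (\<Sum>j=1..n. ?F (?w j) (?u j t)) = ?F z t"
        using partial_sum_fun_multisection[OF assms(1) elim, of "\<lambda>w. w powr (- s)" z]
        by (simp add: partial_sum_fun_def sum_distrib_left scale)
      moreover have "of_nat n powr (- s) * (\<Sum>j=1..n. (?w j + of_real (?u j t)) powr (1 - s) / (1 - s))
         = (z + of_real t) powr (1 - s) / (1 - s)"
      proof -
        have "?w j + of_real (?u j t) = (z + of_real t) / of_nat n" for j
          using n0 by (simp add: field_simps)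
        then have "of_nat n powr (- s) * (\<Sum>j=1..n. (?w j + of_real (?u j t)) powr (1 - s) / (1 - s)) =
           of_nat n powr (- s) * (of_nat n * ((z + of_real t) powr (1 - s) * of_nat n powr (- (1 - s)) / (1 - s)))"
          by (simp add: powr_divide_of_nat[OF n0(1)])
        also have "\<dots> = (of_nat n powr (- s) * of_nat n powr 1 * of_nat n powr (s - 1)) * ((z + of_real t) powr (1 - s) / (1 - s))"
          using n0 by (simp add: mult_ac)
        also have "of_nat n powr (- s) * of_nat n powr 1 * of_nat n powr (s - 1) = (1 :: complex)"
          using n0 by (simp only: powr_add[symmetric]) simp
        finally show ?thesis by simp
      qed
      ultimately show ?case by (simp add: sum_subtractf right_diff_distrib)
    qed
  qed
qed

end
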